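(* Let $s \ge 1$ be an integer. For $X \to \infty$, uniformly with respect to the positive integer $Q \le X$, $$N_s(Q,X) \le X^{2s-1+o(1)} Q^{-s+1}.$$ That is, for every $\varepsilon > 0$ there is $X_0$ (depending only on $s$ and $\varepsilon$) such that for all real $X \ge X_0$ and all integers $Q$ with $1 \le Q \le X$ we have $N_s(Q,X) \le X^{2s-1+\varepsilon} Q^{-s+1}$.
   Context: For $A = \begin{bmatrix} a & b \\ c & d \end{bmatrix} \in \mathrm{SL}_2(\mathbb{Z})$ put $\|A\| = \max\{|a|,|b|,|c|,|d|\}$. For an integer $Q \ge 1$ let $\Gamma_0(Q)$ be the group of all $\begin{bmatrix} a & b \\ c & d \end{bmatrix} \in \mathrm{SL}_2(\mathbb{Z})$ with $c \equiv 0 \pmod Q$, and for $X > 0$ let $\Gamma_0(Q,X) = \{A \in \Gamma_0(Q) : \|A\| \le X\}$. An $s$-tuple $(A_1,\ldots,A_s)$ of matrices in $\mathrm{SL}_2(\mathbb{Z})$ is called free if $A_1,\ldots,A_s$ are free generators of a free subgroup of $\mathrm{SL}_2(\mathbb{Z})$ (of rank $s$), and non-free otherwise. Equivalently, it is non-free if there exist $m \ge 1$, indices $\nu_1,\ldots,\nu_m \in \{1,\ldots,s\}$ and signs $e_1,\ldots,e_m \in \{1,-1\}$, such that there is no $i \in \{1,\ldots,m-1\}$ with $\nu_i = \nu_{i+1}$ and $e_i = -e_{i+1}$, and $A_{\nu_1}^{e_1} \cdots A_{\nu_m}^{e_m} = I_2$, where $I_2$ is the identity matrix. $N_s(Q,X)$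 denotes the number of non-free $s$-tuples $(A_1,\ldots,A_s) \in \Gamma_0(Q,X)^s$. *)

theory Defs
  imports "HOL-Analysis.Analysis" "HOL-Algebra.Generated_Groups" "HOL-Number_Theory.Cong"
begin

section \<open>Free generators\<close>

text \<open>
  A letter \<open>(i, e)\<close> with \<open>e \<in> {1, -1}\<close> stands for the \<open>e\<close>-th power of the \<open>i\<close>-th generator; a
  word over \<open>s\<close> generators uses the indices \<open>0, \<dots>, s - 1\<close>. The reduced words are the elements of
  the free group of rank \<open>s\<close>.
\<close>

definition reduced_words :: "nat \<Rightarrow> (nat \<times> int) list set" where
  "reduced_words s =
     {w. set w \<subseteq> {..<s} \<times> {1, -1} \<and> successively (\<lambda>(i, d) (j, e). \<not> (i = j \<and> d = - e)) w}"

definition word_value :: "('a, 'b) monoid_scheme \<Rightarrow> 'a list \<Rightarrow> (nat \<times> int) list \<Rightarrow> 'a" where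
  "word_value G As w = foldr (\<lambda>(i, e) x. (As ! i) [^]\<^bsub>G\<^esub> e \<otimes>\<^bsub>G\<^esub> x) w \<one>\<^bsub>G\<^esub>"

text \<open>
  The entries of \<open>As\<close> are free generators of the subgroup they generate (which is then free of
  rank \<open>length As\<close>): every element of that subgroup is the value of exactly one reduced word.
  Injectivity on words in the indices forces the entries of \<open>As\<close> to be pairwise distinct.
\<close>

definition free_generators :: "('a, 'b) monoid_scheme \<Rightarrow> 'a list \<Rightarrow> bool" where
  "free_generators G As \<longleftrightarrow>
     bij_betw (word_value G As) (reduced_words (length As)) (generate G (set As))"

context group
begin

lemma word_value_Nil [simp]: "word_value G As [] = \<one>"
  by (simp add: word_value_def)

lemma word_value_Cons [simp]:
  "word_value G As ((i, e) # w) = (As ! i) [^] e \<otimes> word_value G As w"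
  by (simp add: word_value_def)

lemma word_value_closed:
  assumes "set As \<subseteq> carrier G" "set w \<subseteq> {..<length As} \<times> {1, -1}"
  shows "word_value G As w \<in> carrier G"
  using assms(2)
proof (induction w)
  case (Cons a w)
  obtain i e where [simp]: "a = (i, e)" by (cases a)
  have "As ! i \<in> carrier G" using Cons.prems assms(1) by (auto intro: nth_mem)
  with Cons show ?case by auto
qed auto

lemma word_value_append:
  assumes "set As \<subseteq> carrier G" "set u \<subseteq> {..<length As} \<times> {1, -1}"
    "set v \<subseteq> {..<length As} \<times> {1, -1}"
  shows "word_value G As (u @ v) = word_value G As u \<otimes> word_value G As v"
  using assms(2)
proof (induction u)
  case Nil
  then show ?case using word_value_closed[OF assms(1,3)] by simp
next
  case (Cons a u)
  obtain i e where [simp]: "a = (i, e)" by (cases a)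
  have "As ! i \<in> carrier G" using Cons.prems assms(1) by (auto intro: nth_mem)
  moreover have "word_value G As u \<in> carrier G"
    using Cons.prems by (intro word_value_closed assms) auto
  ultimately show ?case
    using Cons word_value_closed[OF assms(1,3)] by (auto simp: m_assoc)
qed

lemma word_value_inverse:
  assumes "set As \<subseteq> carrier G" "set w \<subseteq> {..<length As} \<times> {1, -1}"
  shows "word_value G As (rev (map (\<lambda>(i, e). (i, - e)) w)) = inv (word_value G As w)"
  using assms(2)
proof (induction w)
  case (Cons a w)
  obtain i e where [simp]: "a = (i, e)" by (cases a)
  have A: "As ! i \<in> carrier G" using Cons.prems assms(1) by (auto intro: nth_mem)
  have w: "set w \<subseteq> {..<length As} \<times> {1, -1}" using Cons.prems by auto
  have "set (rev (map (\<lambda>(i, e). (i, - e)) w)) \<subseteq> {..<length As} \<times> {1, -1}"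
    using w by auto
  moreover have "set [(i, - e)] \<subseteq> {..<length As} \<times> {1, -1}" using Cons.prems by auto
  ultimately show ?case
    using Cons.IH[OF w] A word_value_closed[OF assms(1) w]
    by (simp add: word_value_append[OF assms(1)] inv_mult_group int_pow_neg)
qed auto

lemma word_value_reduce:
  assumes "set As \<subseteq> carrier G" "set w \<subseteq> {..<length As} \<times> {1, -1}"
  shows "word_value G As w \<in> word_value G As ` reduced_words (length As)"
  using assms(2)
proof (induction w)
  case Nil
  have "[] \<in> reduced_words (length As)" by (simp add: reduced_words_def)
  then show ?case by blast
next
  case (Cons a w)
  obtain i e where a [simp]: "a = (i, e)" by (cases a)
  have A: "As ! i \<in> carrier G" using Cons.prems assms(1) by (auto intro: nth_mem)
  obtain v where v: "v \<in> reduced_words (length As)" "word_value G As w = word_value G As v"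
    using Cons by auto
  show ?case
  proof (cases "\<exists>v'. v = (i, - e) # v'")
    case True
    then obtain v' where v': "v = (i, - e) # v'" by blast
    have r: "v' \<in> reduced_words (length As)"
      using v(1) v' by (cases v') (auto simp: reduced_words_def)
    have c: "word_value G As v' \<in> carrier G"
      using r by (intro word_value_closed assms) (auto simp: reduced_words_def)
    have "word_value G As (a # w) = word_value G As v'"
      using v(2) v' A c by (simp add: int_pow_neg m_assoc[symmetric])
    then show ?thesis using r by (metis image_eqI)
  next
    case False
    have "a # v \<in> reduced_words (length As)"
      using v(1) False Cons.prems by (cases v) (auto simp: reduced_words_def)
    moreover have "word_value G As (a # w) = word_value G As (a # v)"
      using v(2) by simp
    ultimately show ?thesis by (metis image_eqI)
  qed
qed

lemma word_value_image:
  assumes "set As \<subseteq> carrier G"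
  shows "word_value G As ` reduced_words (length As) = generate G (set As)"
proof (intro equalityI subsetI)
  fix x assume "x \<in> word_value G As ` reduced_words (length As)"
  then obtain w where w: "set w \<subseteq> {..<length As} \<times> {1, -1}" "x = word_value G As w"
    by (auto simp: reduced_words_def)
  have "word_value G As w \<in> generate G (set As)"
    using w(1)
  proof (induction w)
    case Nil
    then show ?case by (simp add: generate.one)
  next
    case (Cons a w)
    obtain i e where a [simp]: "a = (i, e)" by (cases a)
    have i: "As ! i \<in> set As" and e: "e = 1 \<or> e = -1"
      using Cons.prems by auto
    have "As ! i [^] e \<in> generate G (set As)"
      using e i assms generate.incl[OF i] generate.inv[OF i]
      by (auto simp: int_pow_neg subset_iff)
    then show ?case using Cons by (auto intro: generate.eng)
  qed
  with w show "x \<in> generate G (set As)" by simp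
next
  fix x assume "x \<in> generate G (set As)"
  then have "\<exists>w. set w \<subseteq> {..<length As} \<times> {1, -1} \<and> word_value G As w = x"
  proof induction
    case one
    show ?case by (intro exI[of _ "[]"]) auto
  next
    case (incl h)
    then obtain i where "i < length As" "As ! i = h" by (auto simp: in_set_conv_nth)
    with incl assms show ?case by (intro exI[of _ "[(i, 1)]"]) auto
  next
    case (inv h)
    then obtain i where "i < length As" "As ! i = h" by (auto simp: in_set_conv_nth)
    with inv assms show ?case
      by (intro exI[of _ "[(i, -1)]"]) (auto simp: int_pow_neg subset_iff)
  next
    case (eng h1 h2)
    then obtain u v where "set u \<subseteq> {..<length As} \<times> {1, -1}" "word_value G As u = h1"
      "set v \<subseteq> {..<length As} \<times> {1, -1}" "word_value G As v = h2" by blast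
    then show ?case
      using word_value_append[OF assms, of u v] by (intro exI[of _ "u @ v"]) auto
  qed
  then show "x \<in> word_value G As ` reduced_words (length As)"
    using word_value_reduce[OF assms] by blast
qed

lemma inj_on_word_value:
  assumes "set As \<subseteq> carrier G"
    and triv: "\<And>w. w \<in> reduced_words (length As) \<Longrightarrow> word_value G As w = \<one> \<Longrightarrow> w = []"
  shows "inj_on (word_value G As) (reduced_words (length As))"
proof (rule inj_onI)
  fix u v
  assume "u \<in> reduced_words (length As)" "v \<in> reduced_words (length As)"
    "word_value G As u = word_value G As v"
  then show "u = v"
  proof (induction u arbitrary: v)
    case Nil
    then show ?case using triv[of v] by simp
  next
    case (Cons a u)
    show ?case
    proof (cases v)
      case Nil
      then show ?thesis using Cons triv[of "a # u"] by simp
    next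
      case v: (Cons b v')
      obtain i d where a: "a = (i, d)" by (cases a)
      obtain j e where b: "b = (j, e)" by (cases b)
      have subs: "set (a # u) \<subseteq> {..<length As} \<times> {1, -1}" "set v \<subseteq> {..<length As} \<times> {1, -1}"
        using Cons.prems by (auto simp: reduced_words_def)
      have red: "u \<in> reduced_words (length As)" "v' \<in> reduced_words (length As)"
        using Cons.prems unfolding v by (auto simp: reduced_words_def successively_Cons)
      show ?thesis
      proof (cases "a = b")
        case True
        have "As ! i \<in> carrier G" using subs(1) assms(1) a by (auto intro: nth_mem)
        moreover have "word_value G As u \<in> carrier G" "word_value G As v' \<in> carrier G"
          using subs v by (auto intro!: word_value_closed assms(1))
        ultimately have "word_value G As u = word_value G As v'"
          using Cons.prems(3) unfolding v True[symmetric] a by simp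
        then show ?thesis using Cons.IH[OF red] True v by simp
      next
        case False
        let ?u' = "rev (map (\<lambda>(i, e). (i, - e)) (a # u))"
        have u'_sub: "set ?u' \<subseteq> {..<length As} \<times> {1, -1}" using subs(1) by auto
        have "successively (\<lambda>(i, d) (j, e). \<not> (i = j \<and> d = - e)) (a # u)"
          using Cons.prems(1) by (simp add: reduced_words_def)
        then have "successively (\<lambda>(i, d) (j, e). \<not> (i = j \<and> d = - e)) ?u'"
          unfolding successively_rev successively_map
          by (rule successively_mono) auto
        then have "successively (\<lambda>(i, d) (j, e). \<not> (i = j \<and> d = - e)) (?u' @ v)"
          using Cons.prems(2) False unfolding successively_append_iff
          by (auto simp: reduced_words_def a b v)
        then have "?u' @ v \<in> reduced_words (length As)"
          using u'_sub subs(2) by (auto simp: reduced_words_def)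
        moreover have "word_value G As (?u' @ v) = \<one>"
          using word_value_append[OF assms(1) u'_sub subs(2)]
            word_value_inverse[OF assms(1) subs(1)] Cons.prems(3)
            word_value_closed[OF assms(1) subs(2)]
          by simp
        ultimately have "?u' @ v = []" by (rule triv)
        then show ?thesis using v by simp
      qed
    qed
  qed
qed

theorem not_free_generators_iff:
  assumes "set As \<subseteq> carrier G"
  shows "\<not> free_generators G As \<longleftrightarrow>
    (\<exists>w \<in> reduced_words (length As). w \<noteq> [] \<and> word_value G As w = \<one>)"
proof -
  have "[] \<in> reduced_words (length As)" by (simp add: reduced_words_def)
  then have "inj_on (word_value G As) (reduced_words (length As)) \<longleftrightarrow>
      (\<forall>w \<in> reduced_words (length As). word_value G As w = \<one> \<longrightarrow> w = [])"
    using inj_on_word_value[OF assms] word_value_Nil[of As] unfolding inj_on_def by metis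
  then show ?thesis
    using word_value_image[OF assms] by (auto simp: free_generators_def bij_betw_def)
qed

end

section \<open>The modular group\<close>

definition SL2Z :: "(int^2^2) monoid" where
  "SL2Z = \<lparr>carrier = {A. det A = 1}, mult = (**), one = mat 1\<rparr>"

lemma group_SL2Z: "group SL2Z"
proof (rule groupI)
  fix A assume "A \<in> carrier SL2Z"
  then have d: "A$1$1 * A$2$2 - A$1$2 * A$2$1 = 1" by (simp add: SL2Z_def det_2)
  define B :: "int^2^2" where "B = vector [vector [A$2$2, - A$1$2], vector [- A$2$1, A$1$1]]"
  have "det B = 1" using d by (simp add: B_def det_2 algebra_simps)
  moreover have "B ** A = mat 1"
    using d by (simp add: B_def matrix_matrix_mult_def mat_def vec_eq_iff forall_2 sum_2
        algebra_simps)
  ultimately show "\<exists>B \<in> carrier SL2Z. B \<otimes>\<^bsub>SL2Z\<^esub> A = \<one>\<^bsub>SL2Z\<^esub>"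
    by (auto simp: SL2Z_def)
qed (auto simp: SL2Z_def det_mul matrix_mul_assoc)

definition mat_height :: "int^2^2 \<Rightarrow> int" where
  "mat_height A = Max {\<bar>A$1$1\<bar>, \<bar>A$1$2\<bar>, \<bar>A$2$1\<bar>, \<bar>A$2$2\<bar>}"

definition Gamma0 :: "nat \<Rightarrow> (int^2^2) set" where
  "Gamma0 Q = {A \<in> carrier SL2Z. [A$2$1 = 0] (mod int Q)}"

definition Gamma0_upto :: "nat \<Rightarrow> real \<Rightarrow> (int^2^2) set" where
  "Gamma0_upto Q X = {A \<in> Gamma0 Q. real_of_int (mat_height A) \<le> X}"

definition nonfree_tuples :: "nat \<Rightarrow> nat \<Rightarrow> real \<Rightarrow> (int^2^2) list set" where
  "nonfree_tuples s Q X =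
     {As. length As = s \<and> set As \<subseteq> Gamma0_upto Q X \<and> \<not> free_generators SL2Z As}"

definition nonfree_count :: "nat \<Rightarrow> nat \<Rightarrow> real \<Rightarrow> nat" where
  "nonfree_count s Q X = card (nonfree_tuples s Q X)"

lemma finite_Gamma0_upto: "finite (Gamma0_upto Q X)"
proof (rule finite_subset)
  let ?I = "{- \<lfloor>X\<rfloor>..\<lfloor>X\<rfloor>}"
  let ?f = "\<lambda>(a, b, c, d). vector [vector [a, b], vector [c, d]] :: int^2^2"
  show "Gamma0_upto Q X \<subseteq> ?f ` (?I \<times> ?I \<times> ?I \<times> ?I)"
  proof
    fix A assume "A \<in> Gamma0_upto Q X"
    then have "mat_height A \<le> \<lfloor>X\<rfloor>" by (simp add: Gamma0_upto_def le_floor_iff)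
    then have "\<bar>A$1$1\<bar> \<le> \<lfloor>X\<rfloor>" "\<bar>A$1$2\<bar> \<le> \<lfloor>X\<rfloor>" "\<bar>A$2$1\<bar> \<le> \<lfloor>X\<rfloor>" "\<bar>A$2$2\<bar> \<le> \<lfloor>X\<rfloor>"
      by (simp_all add: mat_height_def)
    moreover have "A = ?f (A$1$1, A$1$2, A$2$1, A$2$2)"
      by (simp add: vec_eq_iff forall_2)
    ultimately show "A \<in> ?f ` (?I \<times> ?I \<times> ?I \<times> ?I)"
      by (intro image_eqI[of _ _ "(A$1$1, A$1$2, A$2$1, A$2$2)"]) auto
  qed
qed auto

lemma finite_nonfree_tuples: "finite (nonfree_tuples s Q X)"
  by (rule finite_subset[OF _ finite_lists_length_eq[OF finite_Gamma0_upto, of Q X s]])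
    (auto simp: nonfree_tuples_def)

end

theory Submission
  imports Defs
begin

text \<open>
  Let \<open>T A\<close> be the set of nonzero integer vectors \<open>x\<close> with \<open>|A^-1 x| \<le> |x|\<close> in the maximum norm. If
  \<open>|tr A_i| > 2\<close> for all \<open>i\<close> and the sets \<open>T (A_i^e)\<close> are pairwise disjoint, then each letter of a
  reduced word strictly lengthens a suitable vector, so the tuple is free. Hence in a non-free tuple
  some \<open>A_i\<close> has trace at most \<open>2\<close> in absolute value, or \<open>T (A_i^e)\<close> and \<open>T (A_j^f)\<close> meet for some
  \<open>i \<noteq> j\<close>; the case \<open>i = j\<close>, \<open>f = -e\<close> is covered by the trace since \<open>A x + A^-1 x = (tr A) x\<close>. A common
  vector means that the columns of the two matrices point in nearly the same direction, up to an
  error of the order of the inverse of their norms. So the larger of the two determines a slope near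
  which the columns of the smaller one lie, and only \<open>O(X)\<close> matrices of norm at most \<open>X\<close> do this. By
  the divisor bound there are at most \<open>X^(1 + o(1))\<close> matrices of bounded trace and at most
  \<open>X^(2 + o(1)) / Q\<close> matrices in \<open>\<Gamma>_0(Q, X)\<close>. Thus \<open>s - 1\<close> entries of a non-free tuple are arbitrary
  and the remaining one has \<open>X^(1 + o(1))\<close> possibilities.
\<close>

section \<open>Divisors and fibre counting\<close>

lemma card_divisors_mult_prime_power_le:
  fixes p m :: nat
  assumes "prime p" "m > 0"
  shows "card {d. d dvd p ^ e * m} \<le> (e + 1) * card {d. d dvd m}"
proof -
  have "{d. d dvd p ^ e * m} \<subseteq> (\<lambda>(i, d). p ^ i * d) ` ({..e} \<times> {d. d dvd m})"
  proof
    fix d assume "d \<in> {d. d dvd p ^ e * m}"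
    then obtain x y where "d = x * y" "x dvd p ^ e" "y dvd m"
      using division_decomp by blast
    moreover from this obtain i where "i \<le> e" "x = p ^ i"
      using divides_primepow_nat[OF assms(1)] by blast
    ultimately show "d \<in> (\<lambda>(i, d). p ^ i * d) ` ({..e} \<times> {d. d dvd m})"
      by auto
  qed
  then have "card {d. d dvd p ^ e * m} \<le> card ({..e} \<times> {d. d dvd m})"
    using assms(2) by (intro surj_card_le) auto
  then show ?thesis by (simp add: card_cartesian_product)
qed

text \<open>The cost of one small prime: exponent \<open>e\<close> contributes a factor
  \<open>e + 1\<close> to the number of divisors, while \<open>n powr \<epsilon>\<close> gains at
  least \<open>2 powr (\<epsilon> * e)\<close>. The bound is \<open>1 + x \<le> exp x\<close> at
  \<open>x = \<epsilon> * ln 2 * e\<close>, rescaled.\<close>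

lemma linear_le_exp_linear:
  fixes \<epsilon> :: real
  assumes "\<epsilon> > 0"
  obtains K where "K \<ge> 1" "\<And>e::nat. real e + 1 \<le> K * 2 powr (\<epsilon> * real e)"
proof
  let ?c = "\<epsilon> * ln 2"
  have c: "?c > 0" using assms by simp
  show "1 \<le> max 1 (1 / ?c)" by simp
  fix e :: nat
  have "1 + ?c * real e \<le> 2 powr (\<epsilon> * real e)"
    using exp_ge_add_one_self[of "?c * real e"] by (simp add: powr_def mult_ac)
  then have "max 1 (1 / ?c) * (1 + ?c * real e) \<le> max 1 (1 / ?c) * 2 powr (\<epsilon> * real e)"
    by (intro mult_left_mono) auto
  moreover have "real e = 1 / ?c * (?c * real e)" using assms by simp
  moreover have "1 / ?c * (?c * real e) \<le> max 1 (1 / ?c) * (?c * real e)"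
    using c by (intro mult_right_mono) auto
  ultimately show "real e + 1 \<le> max 1 (1 / ?c) * 2 powr (\<epsilon> * real e)"
    by (simp add: distrib_left)
qed

text \<open>Strip off one prime power at a time. A prime with
  \<open>p powr \<epsilon> \<ge> 2\<close> costs nothing, because \<open>e + 1 \<le> 2 ^ e\<close>;
  each of the finitely many smaller primes costs a factor \<open>K\<close>, at most once.\<close>

lemma card_divisors_le_powr:
  fixes \<epsilon> :: real
  assumes "\<epsilon> > 0"
  obtains C where "C > 0" "\<And>n::nat. n > 0 \<Longrightarrow> real (card {d. d dvd n}) \<le> C * real n powr \<epsilon>"
proof -
  obtain K where K: "K \<ge> 1" "\<And>e::nat. real e + 1 \<le> K * 2 powr (\<epsilon> * real e)"
    using linear_le_exp_linear[OF assms] by metis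
  define S where "S = {p::nat. real p < 2 powr (1 / \<epsilon>)}"
  have "S \<subseteq> {..nat \<lceil>2 powr (1 / \<epsilon>)\<rceil>}" unfolding S_def by (auto simp: le_nat_iff) linarith
  then have finS: "finite S" using finite_subset by blast
  \<comment> \<open>The induction needs a constant that grows only when a small prime is stripped,
    so it depends on \<open>n\<close>; it is bounded by \<open>K ^ card S\<close> at the
    end.\<close>
  define f where "f n = K ^ card (S \<inter> prime_factors n)" for n :: nat
  have "real (card {d. d dvd n}) \<le> f n * real n powr \<epsilon>" if "n > 0" for n :: nat
    using that
  proof (induction n rule: less_induct)
    case (less n)
    show ?case
    proof (cases "n = 1")
      case True
      then show ?thesis by (simp add: f_def)
    next
      case False
      then obtain p where p: "prime p" "p dvd n" using prime_factor_nat by blast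
      define e where "e = multiplicity p n"
      obtain m where m: "n = p ^ e * m" "\<not> p dvd m"
        using multiplicity_decompose'[of n p] less.prems p(1) unfolding e_def
        by (metis not_prime_unit neq0_conv)
      have e: "e > 0" using p less.prems
        by (simp add: e_def prime_multiplicity_gt_zero_iff)
      have m0: "m > 0" using m(1) less.prems by (cases m) auto
      have p2: "p \<ge> 2" using prime_ge_2_nat[OF p(1)] .
      have "p ^ e > 1" using p2 e by (metis one_less_power less_le_trans one_less_numeral_iff semiring_norm(76))
      then have mn: "m < n" using m(1) m0 by simp
      have pf: "prime_factors n = insert p (prime_factors m)"
        using m(1) m0 p e by (simp add: prime_factors_product prime_factorization_prime_power)
      have pm: "p \<notin> prime_factors m" using m(2) by auto
      have step: "(real e + 1) * f m \<le> f n * real p powr (\<epsilon> * real e)"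
      proof (cases "p \<in> S")
        case True
        have fn: "f n = K * f m"
          using True pm finS by (simp add: f_def pf)
        have "2 powr (\<epsilon> * real e) \<le> real p powr (\<epsilon> * real e)"
          using p2 assms by (intro powr_mono2) auto
        then have "real e + 1 \<le> K * real p powr (\<epsilon> * real e)"
          using K(1) by (intro order.trans[OF K(2)] mult_left_mono) auto
        moreover have "f m \<ge> 0" using K(1) by (simp add: f_def)
        ultimately have "(real e + 1) * f m \<le> K * real p powr (\<epsilon> * real e) * f m"
          by (rule mult_right_mono)
        then show ?thesis unfolding fn by (simp only: mult_ac)
      next
        case False
        have "2 = (2 powr (1 / \<epsilon>)) powr \<epsilon>" using assms by (simp add: powr_powr)
        also have "\<dots> \<le> real p powr \<epsilon>" using False assms by (intro powr_mono2) (auto simp: S_def)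
        finally have "2 ^ e \<le> (real p powr \<epsilon>) ^ e" by (intro power_mono) auto
        moreover have "(real p powr \<epsilon>) ^ e = real p powr (\<epsilon> * real e)"
          using p2 powr_power[of "real p" \<epsilon> e] by (metis mult.commute not_numeral_le_zero of_nat_eq_0_iff)
        moreover have "real e + 1 \<le> 2 ^ e"
          using of_nat_mono[OF Suc_leI[OF less_exp[of e]], where 'a = real] by simp
        ultimately have "real e + 1 \<le> real p powr (\<epsilon> * real e)" by linarith
        moreover have "f m \<ge> 0" using K(1) by (simp add: f_def)
        ultimately have "(real e + 1) * f m \<le> real p powr (\<epsilon> * real e) * f m"
          by (rule mult_right_mono)
        moreover have "f n = f m" using False by (simp add: f_def pf)
        ultimately show ?thesis by (simp only: mult.commute)
      qed
      have "real (card {d. d dvd n}) \<le> (real e + 1) * real (card {d. d dvd m})"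
        using of_nat_mono[OF card_divisors_mult_prime_power_le[OF p(1) m0, of e], where 'a = real]
        by (simp add: m(1) distrib_right add.commute)
      also have "\<dots> \<le> (real e + 1) * (f m * real m powr \<epsilon>)"
        using less.IH[OF mn m0] by (intro mult_left_mono) auto
      also have "\<dots> \<le> f n * real p powr (\<epsilon> * real e) * real m powr \<epsilon>"
        using mult_right_mono[OF step, of "real m powr \<epsilon>"] by (simp add: mult_ac)
      also have "real p powr (\<epsilon> * real e) = (real (p ^ e)) powr \<epsilon>"
        using p2 by (simp add: powr_powr flip: powr_realpow) (simp add: mult.commute)
      also have "f n * real (p ^ e) powr \<epsilon> * real m powr \<epsilon> = f n * real n powr \<epsilon>"
        by (simp add: m(1) powr_mult)
      finally show ?thesis .
    qed
  qed
  moreover have "f n \<le> K ^ card S" for n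
    unfolding f_def using K(1) finS by (intro power_increasing card_mono) auto
  ultimately have "real (card {d. d dvd n}) \<le> K ^ card S * real n powr \<epsilon>" if "n > 0" for n :: nat
    using that mult_right_mono[of "f n" "K ^ card S" "real n powr \<epsilon>"] by (meson order.trans powr_ge_zero)
  with K(1) show ?thesis by (intro that[of "K ^ card S"]) auto
qed

text \<open>A pair is determined by the sign and the absolute value of its first entry, whence the
  factor \<open>2\<close>.\<close>

lemma card_factor_pairs_le:
  fixes k :: int
  assumes "k \<noteq> 0"
  shows "finite {(u, v). u * v = k}"
    and "card {(u, v). u * v = k} \<le> 2 * card {d. d dvd nat \<bar>k\<bar>}"
proof -
  let ?D = "{d. d dvd nat \<bar>k\<bar>}"
  let ?g = "\<lambda>(\<sigma>, d). (\<sigma> * int d, k div (\<sigma> * int d))"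
  have fin: "finite ?D" using assms by (intro finite_divisors_nat) simp
  have sub: "{(u, v). u * v = k} \<subseteq> ?g ` ({1, -1} \<times> ?D)"
  proof
    fix z assume "z \<in> {(u, v). u * v = k}"
    then obtain u v where z: "z = (u, v)" "k = u * v" by auto
    have "nat \<bar>u\<bar> \<in> ?D" unfolding z(2) abs_mult by (simp add: nat_mult_distrib)
    moreover have u0: "u \<noteq> 0" using assms z(2) by auto
    then have "sgn u \<in> {1, -1}" by (simp add: sgn_if)
    moreover have "sgn u * int (nat \<bar>u\<bar>) = u" by (simp add: sgn_mult_abs)
    then have "z = ?g (sgn u, nat \<bar>u\<bar>)" using u0 by (simp add: z)
    ultimately show "z \<in> ?g ` ({1, -1} \<times> ?D)" by blast
  qed
  show "finite {(u, v). u * v = k}" using finite_subset[OF sub] fin by blast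
  have "card {(u, v). u * v = k} \<le> card ({1, -1 :: int} \<times> ?D)"
    using sub fin by (intro surj_card_le) auto
  also have "\<dots> = 2 * card ?D" by (simp add: card_cartesian_product)
  finally show "card {(u, v). u * v = k} \<le> 2 * card ?D" .
qed

section \<open>Counting through fibres\<close>

lemma int_interval_card_le:
  fixes t r :: real
  assumes "r \<ge> 0"
  shows "finite {c::int. \<bar>of_int c - t\<bar> \<le> r}" "real (card {c::int. \<bar>of_int c - t\<bar> \<le> r}) \<le> 2 * r + 1"
proof -
  have eq: "{c::int. \<bar>of_int c - t\<bar> \<le> r} = {\<lceil>t - r\<rceil>..\<lfloor>t + r\<rfloor>}"
    by (auto simp: abs_le_iff ceiling_le_iff le_floor_iff)
  show "finite {c::int. \<bar>of_int c - t\<bar> \<le> r}" unfolding eq by simp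
  show "real (card {c::int. \<bar>of_int c - t\<bar> \<le> r}) \<le> 2 * r + 1"
    unfolding eq using assms by (simp add: of_nat_nat) linarith
qed

lemma card_le_card_times_fibres:
  fixes f :: "'a \<Rightarrow> 'b" and K :: real
  assumes "finite B" "f ` A \<subseteq> B"
    and "\<And>y. y \<in> B \<Longrightarrow> finite {x \<in> A. f x = y} \<and> real (card {x \<in> A. f x = y}) \<le> K"
  shows "finite A" "real (card A) \<le> real (card B) * K"
proof -
  have A: "A = (\<Union>y\<in>B. {x \<in> A. f x = y})" using assms(2) by auto
  show "finite A" by (subst A) (use assms in auto)
  have "card A \<le> (\<Sum>y\<in>B. card {x \<in> A. f x = y})"
    by (subst A) (rule card_UN_le[OF assms(1)])
  then have "real (card A) \<le> (\<Sum>y\<in>B. real (card {x \<in> A. f x = y}))"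
    by (metis of_nat_le_iff of_nat_sum)
  also have "\<dots> \<le> (\<Sum>y\<in>B. K)" using assms(3) by (intro sum_mono) blast
  finally show "real (card A) \<le> real (card B) * K" by simp
qed

text \<open>Deleting entry \<open>i\<close> maps these lists to lists of length
  \<open>s - 1\<close>, with fibres no larger than \<open>F R\<close>. The set \<open>F\<close> may
  depend on the remaining list, so that the constrained entry can be tied to another entry of the
  tuple.\<close>

lemma card_lists_constrained_entry_le:
  fixes K :: real
  assumes "finite G" "i < s"
    and "\<And>R. finite (F R) \<and> real (card (F R)) \<le> K"
  shows "real (card {As. length As = s \<and> set As \<subseteq> G \<and> As ! i \<in> F (take i As @ drop (Suc i) As)})
    \<le> real (card G) ^ (s - 1) * K"
proof -
  let ?A = "{As. length As = s \<and> set As \<subseteq> G \<and> As ! i \<in> F (take i As @ drop (Suc i) As)}"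
  let ?f = "\<lambda>As. take i As @ drop (Suc i) As"
  let ?B = "{R. set R \<subseteq> G \<and> length R = s - 1}"
  have fib: "finite {As \<in> ?A. ?f As = R} \<and> real (card {As \<in> ?A. ?f As = R}) \<le> K" for R
  proof -
    have sub: "{As \<in> ?A. ?f As = R} \<subseteq> (\<lambda>x. take i R @ x # drop i R) ` F R"
    proof
      fix As assume As: "As \<in> {As \<in> ?A. ?f As = R}"
      then have R: "R = take i As @ drop (Suc i) As" "i < length As" "As ! i \<in> F R"
        using assms(2) by auto
      then have "As = take i R @ (As ! i) # drop i R"
        using id_take_nth_drop[OF R(2)] by simp
      with R(3) show "As \<in> (\<lambda>x. take i R @ x # drop i R) ` F R" by blast
    qed
    have "card {As \<in> ?A. ?f As = R} \<le> card (F R)"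
      using sub assms(3) by (intro surj_card_le) auto
    then show ?thesis using assms(3)[of R] finite_subset[OF sub] by force
  qed
  have im: "?f ` ?A \<subseteq> ?B"
    using assms(2) by (auto dest!: in_set_takeD in_set_dropD)
  have "real (card ?A) \<le> real (card ?B) * K"
    by (rule card_le_card_times_fibres(2)[OF finite_lists_length_eq[OF assms(1)] im fib])
  then show ?thesis by (simp add: card_lists_length_eq[OF assms(1)])
qed

section \<open>Ping-pong on integer vectors\<close>

text \<open>The adjugate, which is the inverse in determinant \<open>1\<close>. Its entries are
  those of \<open>A\<close> up to order and sign, so inverting preserves the height.\<close>

definition adj2 :: "int^2^2 \<Rightarrow> int^2^2" where
  "adj2 A = vector [vector [A$2$2, - A$1$2], vector [- A$2$1, A$1$1]]"

lemma adj2_nth [simp]: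
  "adj2 A $1$1 = A$2$2" "adj2 A $1$2 = - A$1$2" "adj2 A $2$1 = - A$2$1" "adj2 A $2$2 = A$1$1"
  by (simp_all add: adj2_def)

lemma adj2_adj2 [simp]: "adj2 (adj2 A) = A"
  by (simp add: vec_eq_iff forall_2)

lemma det_adj2 [simp]: "det (adj2 A) = det A"
  by (simp add: det_2)

lemma adj2_mult:
  assumes "det A = 1"
  shows "adj2 A ** A = mat 1" "A ** adj2 A = mat 1"
  using assms
  by (simp_all add: det_2 matrix_matrix_mult_def mat_def vec_eq_iff forall_2 sum_2 algebra_simps)

lemma adj2_mult_vec:
  assumes "det A = 1"
  shows "adj2 A *v (A *v x) = x" "A *v (adj2 A *v x) = x"
  using adj2_mult[OF assms] by (simp_all add: matrix_vector_mul_assoc matrix_vector_mul_lid)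

lemma SL2Z_simps [simp]:
  "A \<in> carrier SL2Z \<longleftrightarrow> det A = 1" "A \<otimes>\<^bsub>SL2Z\<^esub> B = A ** B" "\<one>\<^bsub>SL2Z\<^esub> = mat 1"
  by (simp_all add: SL2Z_def)

lemma inv_SL2Z:
  assumes "det A = 1"
  shows "inv\<^bsub>SL2Z\<^esub> A = adj2 A"
  using group.inv_equality[OF group_SL2Z, of "adj2 A" A] assms adj2_mult by simp

text \<open>Inverses appear as adjugates, so that explicit entries are available. Every exponent
  other than \<open>1\<close> is read as \<open>-1\<close>.\<close>

definition letter :: "(int^2^2) list \<Rightarrow> nat \<times> int \<Rightarrow> int^2^2" where
  "letter As = (\<lambda>(i, e). if e = 1 then As ! i else adj2 (As ! i))"

lemma letter_eq_int_pow:
  assumes "det (As ! i) = 1" "e \<in> {1, -1}"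
  shows "(As ! i) [^]\<^bsub>SL2Z\<^esub> e = letter As (i, e)"
proof -
  interpret group SL2Z by (rule group_SL2Z)
  show ?thesis using assms by (auto simp: letter_def int_pow_neg inv_SL2Z)
qed

section \<open>Growth of vectors under reduced words\<close>

definition vec_height :: "int^2 \<Rightarrow> int" where
  "vec_height x = max \<bar>x$1\<bar> \<bar>x$2\<bar>"

text \<open>
  The analogue of an isometric disc: as \<open>adj2 A\<close> inverts \<open>A\<close>, these are the images \<open>A y\<close> that are
  at least as long as \<open>y \<noteq> 0\<close>.
\<close>

definition grown :: "int^2^2 \<Rightarrow> (int^2) set" where
  "grown A = {x. x \<noteq> 0 \<and> vec_height (adj2 A *v x) \<le> vec_height x}"

lemma mult_vec_nonzero:
  fixes A :: "int^2^2"
  assumes "det A = 1" "x \<noteq> 0"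
  shows "A *v x \<noteq> 0"
  using adj2_mult_vec(1)[OF assms(1), of x] assms(2) by auto

lemma word_value_SL2Z_Cons:
  assumes "det (As ! i) = 1" "e \<in> {1, -1}"
  shows "word_value SL2Z As ((i, e) # w) = letter As (i, e) ** word_value SL2Z As w"
  by (simp add: word_value_def letter_eq_int_pow[OF assms, simplified])

text \<open>Ping-pong, reading the word from its right end. The vector \<open>y\<close> reached so
  far lies in the grown set of the letter \<open>b\<close> just applied. The next letter
  \<open>a\<close> is not inverse to \<open>b\<close>, so by disjointness \<open>y\<close> lies
  outside the grown set of the inverse of \<open>a\<close>, which says exactly that \<open>a\<close>
  lengthens \<open>y\<close>. The image then lies in the grown set of \<open>a\<close>. The last
  letter has no predecessor, so its growth on \<open>x\<close> is a hypothesis.\<close>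

lemma word_grows:
  assumes det: "\<And>i. i < s \<Longrightarrow> det (As ! i) = 1"
    and disj: "\<And>a b. a \<in> {..<s} \<times> {1, -1} \<Longrightarrow> b \<in> {..<s} \<times> {1, -1} \<Longrightarrow> a \<noteq> b \<Longrightarrow>
      grown (letter As a) \<inter> grown (letter As b) = {}"
    and "w \<in> reduced_words s" "w \<noteq> []" "x \<noteq> 0"
    and "vec_height x < vec_height (letter As (last w) *v x)"
  shows "vec_height x < vec_height (word_value SL2Z As w *v x) \<and>
    word_value SL2Z As w *v x \<in> grown (letter As (hd w))"
  using assms(3,4,6)
proof (induction w)
  case (Cons a w)
  obtain i e where a: "a = (i, e)" by (cases a)
  have ie: "i < s" "e \<in> {1, -1}" using Cons.prems a by (auto simp: reduced_words_def)
  have dl: "det (letter As a) = 1" using det[OF ie(1)] by (simp add: a letter_def)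
  let ?y = "word_value SL2Z As w *v x"
  have val: "word_value SL2Z As (a # w) *v x = letter As a *v ?y"
    using word_value_SL2Z_Cons[OF det[OF ie(1)] ie(2)] by (simp add: a matrix_vector_mul_assoc)
  have "vec_height x \<le> vec_height ?y \<and> ?y \<noteq> 0 \<and> vec_height ?y < vec_height (letter As a *v ?y)"
  proof (cases w)
    case Nil
    then show ?thesis
      using Cons.prems assms(5) group.word_value_Nil[OF group_SL2Z, of As] by (simp add: matrix_vector_mul_lid)
  next
    case (Cons b w')
    obtain j d where b: "b = (j, d)" by (cases b)
    have red: "w \<in> reduced_words s" "b \<noteq> (i, - e)" "j < s" "d \<in> {1, -1}"
      using Cons.prems(1) unfolding Cons a b by (auto simp: reduced_words_def)
    have IH: "vec_height x < vec_height ?y" "?y \<in> grown (letter As b)"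
      using Cons.IH red(1) Cons.prems(3) by (auto simp: Cons)
    have "(i, - e) \<in> {..<s} \<times> {1, -1}" "b \<in> {..<s} \<times> {1, -1}"
      using ie red b by auto
    then have "?y \<notin> grown (letter As (i, - e))"
      using disj red(2) IH(2) by blast
    moreover have "adj2 (letter As (i, - e)) = letter As a"
      using ie(2) by (auto simp: letter_def a)
    moreover have "?y \<noteq> 0" using IH(2) by (simp add: grown_def)
    ultimately show ?thesis using IH(1) by (simp add: grown_def)
  qed
  then show ?case
    unfolding val using adj2_mult_vec(1)[OF dl] mult_vec_nonzero[OF dl]
    by (simp add: grown_def)
qed simp

text \<open>One of the diagonal entries exceeds \<open>1\<close> in absolute value, and the
  corresponding unit vector, of height \<open>1\<close>, is lengthened.\<close>

lemma exists_grown_vector: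
  assumes "\<bar>A$1$1 + A$2$2\<bar> > 2"
  obtains x where "x \<noteq> 0" "vec_height x < vec_height (A *v x)"
proof (cases "\<bar>A$1$1\<bar> > 1")
  case True
  show ?thesis
    by (rule that[of "axis 1 1"]) (use True in \<open>auto simp: vec_height_def axis_def matrix_vector_mult_def sum_2 vec_eq_iff\<close>)
next
  case False
  then have "\<bar>A$2$2\<bar> > 1" using assms by linarith
  then show ?thesis
    by (intro that[of "axis 2 1"]) (auto simp: vec_height_def axis_def matrix_vector_mult_def sum_2 vec_eq_iff)
qed

text \<open>Otherwise a nonempty reduced word of value \<open>mat 1\<close> would strictly lengthen
  a vector that it fixes. The trace condition, which is invariant under inversion, supplies the
  vector on which its last letter starts the growth.\<close>

lemma not_free_imp_grown_meet:
  assumes det: "\<And>A. A \<in> set As \<Longrightarrow> det A = 1"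
    and trace: "\<And>A. A \<in> set As \<Longrightarrow> \<bar>A$1$1 + A$2$2\<bar> > 2"
    and "\<not> free_generators SL2Z As"
  obtains a b where "a \<in> {..<length As} \<times> {1, -1}" "b \<in> {..<length As} \<times> {1, -1}" "a \<noteq> b"
    "grown (letter As a) \<inter> grown (letter As b) \<noteq> {}"
proof (rule ccontr)
  assume "\<not> thesis"
  with that have disj: "\<And>a b. a \<in> {..<length As} \<times> {1, -1} \<Longrightarrow> b \<in> {..<length As} \<times> {1, -1} \<Longrightarrow> a \<noteq> b \<Longrightarrow>
      grown (letter As a) \<inter> grown (letter As b) = {}" by blast
  have "set As \<subseteq> carrier SL2Z" using det by auto
  then obtain w where w: "w \<in> reduced_words (length As)" "w \<noteq> []" "word_value SL2Z As w = mat 1"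
    using group.not_free_generators_iff[OF group_SL2Z] assms(3) by auto
  obtain i e where l: "last w = (i, e)" by (cases "last w")
  have i: "i < length As" using last_in_set[OF w(2)] w(1) l by (auto simp: reduced_words_def)
  have "\<bar>letter As (last w) $1$1 + letter As (last w) $2$2\<bar> > 2"
    using trace[OF nth_mem[OF i]] by (simp add: l letter_def add.commute)
  then obtain x where "x \<noteq> 0" "vec_height x < vec_height (letter As (last w) *v x)"
    using exists_grown_vector by blast
  from word_grows[OF _ disj w(1,2) this] show False
    using det w(3) by (simp add: matrix_vector_mul_lid)
qed

section \<open>Slopes of matrices whose grown sets meet\<close>

lemma grown_slope:
  fixes k l :: 2
  assumes "k \<noteq> l" "x \<in> grown A" "\<bar>x$l\<bar> \<le> \<bar>x$k\<bar>"
  shows "x$k \<noteq> 0" "\<bar>of_int (A$l$q) - of_int (x$l) / of_int (x$k) * of_int (A$k$q)\<bar> \<le> (1::real)"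
proof -
  have kl: "k = 1 \<and> l = 2 \<or> k = 2 \<and> l = 1" using assms(1) exhaust_2[of k] exhaust_2[of l] by auto
  show x0: "x$k \<noteq> 0"
  proof
    assume "x$k = 0"
    then have "x = 0" using assms(3) kl by (auto simp: vec_eq_iff forall_2)
    then show False using assms(2) by (simp add: grown_def)
  qed
  have h: "vec_height x = \<bar>x$k\<bar>" using assms(3) kl by (auto simp: vec_height_def)
  \<comment> \<open>The coordinates of \<open>adj2 A *v x\<close> are, up to sign, the determinants
    of \<open>x\<close> against the columns of \<open>A\<close>.\<close>
  have "\<bar>A$l$q * x$k - A$k$q * x$l\<bar> \<le> vec_height (adj2 A *v x)" for q
    using kl exhaust_2[of q]
    by (auto simp: vec_height_def matrix_vector_mult_def sum_2 algebra_simps)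
  then have "\<bar>A$l$q * x$k - A$k$q * x$l\<bar> \<le> \<bar>x$k\<bar>"
    using assms(2) h unfolding grown_def by (metis (mono_tags, lifting) mem_Collect_eq order.trans)
  then have "\<bar>of_int (A$l$q) * of_int (x$k) - of_int (A$k$q) * of_int (x$l)\<bar> \<le> \<bar>of_int (x$k) :: real\<bar>"
    by (metis of_int_abs of_int_diff of_int_le_iff of_int_mult)
  moreover have "of_int (A$l$q) * of_int (x$k) - of_int (A$k$q) * of_int (x$l)
      = (of_int (A$l$q) - of_int (x$l) / of_int (x$k) * of_int (A$k$q)) * (of_int (x$k) :: real)"
    using x0 by (simp add: field_simps)
  ultimately show "\<bar>of_int (A$l$q) - of_int (x$l) / of_int (x$k) * of_int (A$k$q)\<bar> \<le> (1::real)"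
    using x0 by (simp add: abs_mult)
qed

text \<open>Cayley-Hamilton: \<open>A\<close> and \<open>adj2 A\<close> add up to the trace times
  the identity. In a dominant coordinate of \<open>x\<close> both images are at most
  \<open>\<bar>x$k\<bar>\<close> in size.\<close>

lemma grown_inverse_trace:
  assumes "x \<in> grown A" "x \<in> grown (adj2 A)"
  shows "\<bar>A$1$1 + A$2$2\<bar> \<le> 2"
proof -
  have "\<exists>k. vec_height x = \<bar>x$k\<bar>" unfolding vec_height_def by (metis max_def)
  then obtain k where k: "vec_height x = \<bar>x$k\<bar>" by blast
  have le: "\<bar>y$k\<bar> \<le> vec_height y" for y
    using exhaust_2[of k] by (auto simp: vec_height_def)
  have "(A *v x)$k + (adj2 A *v x)$k = (A$1$1 + A$2$2) * x$k"
    using exhaust_2[of k] by (auto simp: matrix_vector_mult_def sum_2 algebra_simps)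
  then have "\<bar>A$1$1 + A$2$2\<bar> * \<bar>x$k\<bar> \<le> 2 * \<bar>x$k\<bar>"
    using assms le[of "A *v x"] le[of "adj2 A *v x"] k unfolding grown_def
    by (simp add: abs_mult[symmetric]) linarith
  moreover have "\<bar>x$k\<bar> > 0"
    using k assms(1) unfolding grown_def vec_height_def
    by (auto simp: vec_eq_iff forall_2 max_def split: if_splits)
  ultimately show ?thesis by simp
qed

text \<open>
  A vector in \<open>grown B\<close> has the direction of the columns of \<open>B\<close>; the column whose entry in row \<open>k\<close> is
  the larger one approximates this direction best. The pair \<open>(k, l)\<close> selects the chart of the
  projective line in which coordinate \<open>k\<close> is dominant.
\<close>

definition slope :: "2 \<Rightarrow> 2 \<Rightarrow> int^2^2 \<Rightarrow> real" where
  "slope k l B = (let q = if \<bar>B$k$2\<bar> \<le> \<bar>B$k$1\<bar> then 1 else 2 in of_int (B$l$q) / of_int (B$k$q))"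

definition near_slope :: "2 \<Rightarrow> 2 \<Rightarrow> real \<Rightarrow> (int^2^2) set" where
  "near_slope k l \<theta> = {A. det A = 1 \<and> (\<forall>q. \<bar>of_int (A$l$q) - \<theta> * of_int (A$k$q)\<bar> \<le> 2)}"

text \<open>The chart depends on the common vector, which is not recorded, so both charts are
  allowed.\<close>

definition close_to :: "int^2^2 \<Rightarrow> (int^2^2) set" where
  "close_to B = near_slope 1 2 (slope 1 2 B) \<union> near_slope 2 1 (slope 2 1 B)"

text \<open>If \<open>b\<close> is the largest entry in row \<open>k\<close> of \<open>B\<close>,
  the slope of \<open>B\<close> differs from \<theta> by at most \<open>1 / \<bar>b\<bar>\<close>.
  The entries of \<open>A\<close> in row \<open>k\<close> are at most \<open>\<bar>b\<bar>\<close>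
  in size, so replacing \<theta> costs one more unit; hence the tolerance \<open>2\<close> in
  \<open>near_slope\<close>.\<close>

lemma near_slope_of_common_slope:
  assumes "k \<noteq> l" "det A = 1" "det B = 1"
    and A: "\<And>q. \<bar>of_int (A$l$q) - \<theta> * of_int (A$k$q)\<bar> \<le> (1::real)"
    and B: "\<And>q. \<bar>of_int (B$l$q) - \<theta> * of_int (B$k$q)\<bar> \<le> (1::real)"
    and le: "max \<bar>A$k$1\<bar> \<bar>A$k$2\<bar> \<le> max \<bar>B$k$1\<bar> \<bar>B$k$2\<bar>"
  shows "A \<in> near_slope k l (slope k l B)"
proof -
  define q :: 2 where "q = (if \<bar>B$k$2\<bar> \<le> \<bar>B$k$1\<bar> then 1 else 2)"
  have \<phi>: "slope k l B = of_int (B$l$q) / of_int (B$k$q)" by (simp add: slope_def q_def)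
  have mx: "max \<bar>B$k$1\<bar> \<bar>B$k$2\<bar> = \<bar>B$k$q\<bar>" by (simp add: q_def max_def)
  have b0: "B$k$q \<noteq> 0"
  proof
    assume "B$k$q = 0"
    then have "B$k$1 = 0" "B$k$2 = 0" using mx by auto
    then show False using assms(3) exhaust_2[of k] by (auto simp: det_2)
  qed
  let ?b = "of_int (B$k$q) :: real"
  have "\<bar>slope k l B - \<theta>\<bar> * \<bar>?b\<bar> \<le> 1"
    using B[of q] b0 unfolding \<phi> abs_mult[symmetric] by (simp add: left_diff_distrib)
  moreover have "\<bar>of_int (A$k$p)\<bar> \<le> \<bar>?b\<bar>" for p
    using le exhaust_2[of p] unfolding mx by (metis max.bounded_iff of_int_abs of_int_le_iff)
  ultimately have "\<bar>slope k l B - \<theta>\<bar> * \<bar>of_int (A$k$p)\<bar> \<le> 1" for p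
    by (meson abs_ge_zero mult_left_mono order.trans)
  then have "\<bar>(slope k l B - \<theta>) * of_int (A$k$p)\<bar> \<le> 1" for p by (simp add: abs_mult)
  then have "\<bar>of_int (A$l$p) - slope k l B * of_int (A$k$p)\<bar> \<le> 2" for p
    using A[of p] by (simp add: left_diff_distrib abs_le_iff) (smt (verit))
  then show ?thesis using assms(2) by (simp add: near_slope_def)
qed

text \<open>The larger coordinate of \<open>x\<close> selects the chart; the matrix with the larger
  entries in row \<open>k\<close> then provides the slope for the other one. Either matrix may be
  the larger, hence the disjunction.\<close>

lemma grown_meet_imp_close:
  assumes "det A = 1" "det B = 1" "x \<in> grown A" "x \<in> grown B"
  shows "A \<in> close_to B \<or> B \<in> close_to A"
proof -
  have "A \<in> near_slope k l (slope k l B) \<or> B \<in> near_slope k l (slope k l A)"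
    if "k \<noteq> l" "\<bar>x$l\<bar> \<le> \<bar>x$k\<bar>" for k l
    using near_slope_of_common_slope[OF that(1)] grown_slope(2)[OF that(1) _ that(2)] assms
    by (meson linear)
  from this[of 1 2] this[of 2 1] show ?thesis
    unfolding close_to_def by fastforce
qed

text \<open>
  The larger entry \<open>A$k$p\<close> of the row fixes its column up to five choices, and the determinant
  equation then fixes the other column up to adding multiples of this one.
\<close>

lemma card_near_slope_column:
  fixes k l p q :: 2 and \<theta> X :: real
  assumes "k \<noteq> l" "p \<noteq> q" "X \<ge> 1"
  defines "S \<equiv> {A. A \<in> near_slope k l \<theta> \<and> \<bar>real_of_int (A$k$p)\<bar> \<le> X \<and> \<bar>A$k$q\<bar> \<le> \<bar>A$k$p\<bar>}"
  shows "finite S" "real (card S) \<le> 75 * X"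
proof -
  have klpq: "k = 1 \<and> l = 2 \<or> k = 2 \<and> l = 1" "p = 1 \<and> q = 2 \<or> p = 2 \<and> q = 1"
    using assms(1,2) exhaust_2 by metis+
  obtain \<delta> :: int where \<delta>: "\<And>A :: int^2^2. A$k$p * A$l$q - A$k$q * A$l$p = \<delta> * det A" "\<bar>\<delta>\<bar> = 1"
  proof
    show "A$k$p * A$l$q - A$k$q * A$l$p = (if k = p then 1 else -1) * det A" for A :: "int^2^2"
      using klpq by (auto simp: det_2)
  qed simp
  let ?f = "\<lambda>A :: int^2^2. (A$k$p, A$l$p)"
  let ?B = "SIGMA u : {u. \<bar>of_int u - 0\<bar> \<le> X}. {v. \<bar>of_int v - \<theta> * of_int u\<bar> \<le> 2}"
  have finB: "finite ?B"
    using assms(3) by (intro finite_SigmaI int_interval_card_le(1)) auto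
  have im: "?f ` S \<subseteq> ?B" by (auto simp: S_def near_slope_def)
  have fib: "finite {A \<in> S. ?f A = y} \<and> real (card {A \<in> S. ?f A = y}) \<le> 5" for y
  proof (cases "{A \<in> S. ?f A = y} = {}")
    case False
    then obtain A0 where A0: "A0 \<in> S" "?f A0 = y" by blast
    obtain u v where y: "y = (u, v)" by (cases y)
    have eq0: "u * A0$l$q - A0$k$q * v = \<delta>" "\<bar>A0$k$q\<bar> \<le> \<bar>u\<bar>"
      using A0 \<delta>(1)[of A0] by (auto simp: S_def near_slope_def y)
    have u0: "u \<noteq> 0" using eq0 \<delta>(2) by auto
    have cop: "coprime u v"
    proof (rule coprimeI)
      fix c assume "c dvd u" "c dvd v"
      then have "c dvd \<delta>" unfolding eq0(1)[symmetric] by simp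
      then show "is_unit c" using \<delta>(2) by (metis dvd_abs_iff)
    qed
    \<comment> \<open>As \<open>u\<close> and \<open>v\<close> are coprime, column \<open>q\<close>
      of any member of the fibre differs from that of \<open>A0\<close> by \<open>t\<close> times
      column \<open>p\<close>. Both entries in row \<open>k\<close> are at most
      \<open>\<bar>u\<bar>\<close> in size, so \<open>\<bar>t\<bar> \<le> 2\<close>, which leaves
      five matrices.\<close>
    let ?g = "\<lambda>t. (\<chi> i j. if j = p then A0$i$j else A0$i$j + t * A0$i$p) :: int^2^2"
    have sub: "{A \<in> S. ?f A = y} \<subseteq> ?g ` {-2..2}"
    proof
      fix A assume A: "A \<in> {A \<in> S. ?f A = y}"
      have eq: "u * A$l$q - A$k$q * v = \<delta>" "\<bar>A$k$q\<bar> \<le> \<bar>u\<bar>" "A$k$p = u" "A$l$p = v"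
        using A \<delta>(1)[of A] by (auto simp: S_def near_slope_def y)
      have e: "u * (A$l$q - A0$l$q) = (A$k$q - A0$k$q) * v"
        using eq(1) eq0(1) by (simp add: algebra_simps)
      then have "u dvd (A$k$q - A0$k$q) * v" by (metis dvd_triv_left)
      then have "u dvd A$k$q - A0$k$q" using cop by (simp add: coprime_dvd_mult_left_iff)
      then obtain t where t: "A$k$q - A0$k$q = u * t" by blast
      have "\<bar>u\<bar> * \<bar>t\<bar> \<le> \<bar>u\<bar> * 2"
        unfolding abs_mult[symmetric] t[symmetric] using eq(2) eq0(2) by linarith
      then have "t \<in> {-2..2}" using u0 by auto
      moreover have "A$l$q - A0$l$q = t * v" using e t u0 by (simp add: mult.assoc)
      moreover have "A0$k$p = u" "A0$l$p = v" using A0(2) y by auto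
      ultimately have "A = ?g t" using t eq klpq
        by (auto simp: vec_eq_iff forall_2 algebra_simps)
      then show "A \<in> ?g ` {-2..2}" using \<open>t \<in> {-2..2}\<close> by blast
    qed
    have "card {A \<in> S. ?f A = y} \<le> card {-2..2::int}"
      using sub by (intro surj_card_le) auto
    then show ?thesis using finite_subset[OF sub] by auto
  next
    case True
    show ?thesis unfolding True by simp
  qed
  show "finite S" by (rule card_le_card_times_fibres(1)[OF finB im fib])
  \<comment> \<open>There are at most \<open>2 * X + 1 \<le> 3 * X\<close> values of
    \<open>u\<close> and, for each, at most five integers \<open>v\<close> in an interval of length
    \<open>4\<close>; five matrices per pair then give \<open>75 * X\<close>.\<close>
  have "real (card ?B) \<le> real (card {u::int. \<bar>of_int u - 0\<bar> \<le> X}) * 5"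
  proof (rule card_le_card_times_fibres(2)[where f = fst])
    fix u :: int
    let ?V = "{v::int. \<bar>of_int v - \<theta> * of_int u\<bar> \<le> 2}"
    have sub: "{z \<in> ?B. fst z = u} \<subseteq> Pair u ` ?V" by auto
    have fV: "finite ?V" using int_interval_card_le(1)[of 2] by simp
    have "card {z \<in> ?B. fst z = u} \<le> card ?V" using sub fV by (rule surj_card_le[rotated])
    moreover have "real (card ?V) \<le> 5" using int_interval_card_le(2)[of 2 "\<theta> * of_int u"] by simp
    ultimately show "finite {z \<in> ?B. fst z = u} \<and> real (card {z \<in> ?B. fst z = u}) \<le> 5"
      using finite_subset[OF sub] fV by auto
  qed (use assms(3) int_interval_card_le(1)[of X 0] in auto)
  also have "\<dots> \<le> (2 * X + 1) * 5"
    using assms(3) int_interval_card_le(2)[of X 0] by (intro mult_right_mono) auto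
  finally have "real (card ?B) \<le> 15 * X" using assms(3) by simp
  then show "real (card S) \<le> 75 * X"
    using card_le_card_times_fibres(2)[OF finB im fib] by linarith
qed

section \<open>Counting matrices and tuples\<close>

definition SL2Z_upto :: "real \<Rightarrow> (int^2^2) set" where
  "SL2Z_upto X = {A. det A = 1 \<and> (\<forall>i j. \<bar>real_of_int (A$i$j)\<bar> \<le> X)}"

lemma mat_height_le_iff: "real_of_int (mat_height A) \<le> X \<longleftrightarrow> (\<forall>i j. \<bar>real_of_int (A$i$j)\<bar> \<le> X)"
  unfolding le_floor_iff[symmetric] of_int_abs[symmetric]
  by (simp add: mat_height_def forall_2)

lemma Gamma0_upto_eq: "Gamma0_upto Q X = {A \<in> SL2Z_upto X. int Q dvd A$2$1}"
  by (auto simp: Gamma0_upto_def Gamma0_def SL2Z_upto_def mat_height_le_iff cong_0_iff)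

lemma adj2_in_SL2Z_upto [simp]: "adj2 A \<in> SL2Z_upto X \<longleftrightarrow> A \<in> SL2Z_upto X"
  by (auto simp: SL2Z_upto_def forall_2)

lemma card_int_le:
  assumes "X \<ge> 1"
  shows "finite {u::int. \<bar>real_of_int u\<bar> \<le> X}" "real (card {u::int. \<bar>real_of_int u\<bar> \<le> X}) \<le> 3 * X"
  using int_interval_card_le[of X 0] assms by auto

lemma card_near_slope:
  assumes "k \<noteq> l" "X \<ge> 1"
  shows "finite (near_slope k l \<theta> \<inter> SL2Z_upto X)"
    "real (card (near_slope k l \<theta> \<inter> SL2Z_upto X)) \<le> 150 * X"
proof -
  define S where "S p q = {A. A \<in> near_slope k l \<theta> \<and> \<bar>real_of_int (A$k$p)\<bar> \<le> X \<and>
    \<bar>A$k$q\<bar> \<le> \<bar>A$k$p\<bar>}" for p q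
  have S: "finite (S p q)" "real (card (S p q)) \<le> 75 * X" if "p \<noteq> q" for p q
    unfolding S_def using card_near_slope_column[OF assms(1) that assms(2)] by blast+
  \<comment> \<open>Either column can hold the larger entry of row \<open>k\<close>, which doubles
    the bound.\<close>
  have sub: "near_slope k l \<theta> \<inter> SL2Z_upto X \<subseteq> S 1 2 \<union> S 2 1"
    by (auto simp: S_def SL2Z_upto_def)
  show "finite (near_slope k l \<theta> \<inter> SL2Z_upto X)"
    using finite_subset[OF sub] S(1) by simp
  have "card (near_slope k l \<theta> \<inter> SL2Z_upto X) \<le> card (S 1 2) + card (S 2 1)"
    using card_mono[OF _ sub] S(1) card_Un_le[of "S 1 2" "S 2 1"] by force
  then show "real (card (near_slope k l \<theta> \<inter> SL2Z_upto X)) \<le> 150 * X"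
    using S(2)[of 1 2] S(2)[of 2 1] by simp
qed

lemma card_close_to:
  assumes "X \<ge> 1"
  shows "finite (close_to B \<inter> SL2Z_upto X)" "real (card (close_to B \<inter> SL2Z_upto X)) \<le> 300 * X"
proof -
  have eq: "close_to B \<inter> SL2Z_upto X = near_slope 1 2 (slope 1 2 B) \<inter> SL2Z_upto X \<union>
      near_slope 2 1 (slope 2 1 B) \<inter> SL2Z_upto X"
    by (auto simp: close_to_def)
  show "finite (close_to B \<inter> SL2Z_upto X)"
    unfolding eq using card_near_slope(1)[OF _ assms] by simp
  show "real (card (close_to B \<inter> SL2Z_upto X)) \<le> 300 * X"
    using card_near_slope(2)[OF _ assms, of 1 2 "slope 1 2 B"]
      card_near_slope(2)[OF _ assms, of 2 1 "slope 2 1 B"]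
      card_Un_le[of "near_slope 1 2 (slope 1 2 B) \<inter> SL2Z_upto X"
        "near_slope 2 1 (slope 2 1 B) \<inter> SL2Z_upto X"]
    unfolding eq by simp
qed

text \<open>Grown sets meet for letters, that is, for matrices up to inversion, so all four
  combinations of signs are collected.\<close>

definition linked :: "real \<Rightarrow> int^2^2 \<Rightarrow> (int^2^2) set" where
  "linked X B = (\<Union>C\<in>{B, adj2 B}. close_to C \<inter> SL2Z_upto X \<union> adj2 ` (close_to C \<inter> SL2Z_upto X))"

lemma card_linked:
  assumes "X \<ge> 1"
  shows "finite (linked X B)" "real (card (linked X B)) \<le> 1200 * X"
proof -
  let ?S = "\<lambda>C. close_to C \<inter> SL2Z_upto X"
  have S: "finite (?S C)" "real (card (?S C)) \<le> 300 * X" for C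
    using card_close_to[OF assms] by auto
  then show "finite (linked X B)" by (simp add: linked_def)
  have T: "real (card (?S C \<union> adj2 ` ?S C)) \<le> 600 * X" for C
    using card_Un_le[of "?S C" "adj2 ` ?S C"] card_image_le[OF S(1), of adj2 C] S(2)[of C] by linarith
  have "card (linked X B) \<le> card (?S B \<union> adj2 ` ?S B) + card (?S (adj2 B) \<union> adj2 ` ?S (adj2 B))"
    unfolding linked_def by (simp add: card_Un_le)
  then show "real (card (linked X B)) \<le> 1200 * X"
    using T[of B] T[of "adj2 B"] by linarith
qed

definition small_trace :: "real \<Rightarrow> (int^2^2) set" where
  "small_trace X = {A \<in> SL2Z_upto X. \<bar>A$1$1 + A$2$2\<bar> \<le> 2}"

text \<open>Without an entry of small trace, the grown sets of two different letters meet. On the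
  same index these would be mutually inverse, which forces a small trace; so the indices differ, and
  closeness in one direction or the other links the two entries.\<close>

lemma nonfree_cases:
  assumes "set As \<subseteq> SL2Z_upto X" "\<not> free_generators SL2Z As"
  shows "(\<exists>i<length As. As ! i \<in> small_trace X) \<or>
    (\<exists>i<length As. \<exists>j<length As. i \<noteq> j \<and> As ! i \<in> linked X (As ! j))"
proof (rule disj_imp[THEN iffD2], rule impI)
  assume no: "\<not> (\<exists>i<length As. As ! i \<in> small_trace X)"
  have det: "\<And>A. A \<in> set As \<Longrightarrow> det A = 1" using assms(1) by (auto simp: SL2Z_upto_def)
  have trace: "\<bar>A$1$1 + A$2$2\<bar> > 2" if "A \<in> set As" for A
    using no assms(1) that by (force simp: in_set_conv_nth small_trace_def)
  obtain a b where ab: "a \<in> {..<length As} \<times> {1, -1}" "b \<in> {..<length As} \<times> {1, -1}" "a \<noteq> b"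
    "grown (letter As a) \<inter> grown (letter As b) \<noteq> {}"
    using not_free_imp_grown_meet[OF det trace assms(2)] by blast
  then obtain x where x: "x \<in> grown (letter As a)" "x \<in> grown (letter As b)" by blast
  obtain i e j f where ij: "a = (i, e)" "b = (j, f)" by (cases a, cases b)
  have lt: "i < length As" "j < length As" "e \<in> {1, -1}" "f \<in> {1, -1}" using ab ij by auto
  note AB = nth_mem[OF lt(1)] nth_mem[OF lt(2)]
  have "i \<noteq> j"
  proof
    assume "i = j"
    then have "e \<noteq> f" using ab(3) ij by simp
    then have "x \<in> grown (As ! i) \<and> x \<in> grown (adj2 (As ! i))"
      using x lt(3,4) \<open>i = j\<close> unfolding ij by (auto simp: letter_def split: if_splits)
    then show False using grown_inverse_trace trace[OF AB(1)] by fastforce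
  qed
  have dets: "det (letter As a) = 1" "det (letter As b) = 1"
    using det[OF AB(1)] det[OF AB(2)] by (simp_all add: ij letter_def)
  \<comment> \<open>Stated for arbitrary letters because it is used in both directions.\<close>
  have link: "As ! i' \<in> linked X (As ! j')"
    if "letter As (i', e') \<in> close_to (letter As (j', f'))" "i' < length As" for i' j' e' f'
  proof -
    let ?S = "close_to (letter As (j', f')) \<inter> SL2Z_upto X"
    have "As ! i' \<in> SL2Z_upto X" using assms(1) that(2) nth_mem by blast
    then have L: "letter As (i', e') \<in> ?S" using that(1) by (simp add: letter_def)
    have "As ! i' = letter As (i', e') \<or> As ! i' = adj2 (letter As (i', e'))"
      by (simp add: letter_def)
    then have "As ! i' \<in> ?S \<union> adj2 ` ?S"
      using UnI1[OF L] UnI2[OF imageI[OF L]] by (elim disjE) (simp_all only:)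
    moreover have "letter As (j', f') \<in> {As ! j', adj2 (As ! j')}" by (simp add: letter_def)
    ultimately show ?thesis unfolding linked_def by blast
  qed
  from grown_meet_imp_close[OF dets x]
  show "\<exists>i<length As. \<exists>j<length As. i \<noteq> j \<and> As ! i \<in> linked X (As ! j)"
    using link[of i e j f] link[of j f i e] \<open>i \<noteq> j\<close> lt unfolding ij by metis
qed

section \<open>Counts for small trace and for \<open>Gamma0\<close> from the divisor bound\<close>

text \<open>
  Both counts below prescribe one product of two entries, so that the divisor bound controls the
  fibres; the fibres over the product \<open>0\<close> are large but lie over few points.
\<close>

lemma card_bounded_factor_pairs:
  fixes \<epsilon> :: real
  assumes "\<epsilon> > 0"
  obtains C where "C > 0"
    "\<And>X k. X \<ge> 1 \<Longrightarrow> k \<noteq> 0 \<Longrightarrow> \<bar>real_of_int k\<bar> \<le> 2 * X\<^sup>2 \<Longrightarrow>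
      finite {(u, v). u * v = k} \<and> real (card {(u, v). u * v = k}) \<le> C * X powr \<epsilon>"
proof -
  \<comment> \<open>Half of \<epsilon>, because \<open>k\<close> may be as large as
    \<open>2 * X\<^sup>2\<close>.\<close>
  obtain C where C: "C > 0" "\<And>n::nat. n > 0 \<Longrightarrow> real (card {d. d dvd n}) \<le> C * real n powr (\<epsilon> / 2)"
    using card_divisors_le_powr[of "\<epsilon> / 2"] assms by auto
  show ?thesis
  proof (rule that[of "2 * C * 2 powr (\<epsilon> / 2)"])
    fix X :: real and k :: int
    assume X: "X \<ge> 1" and k: "k \<noteq> 0" "\<bar>real_of_int k\<bar> \<le> 2 * X\<^sup>2"
    have "real (card {(u, v). u * v = k}) \<le> 2 * real (card {d. d dvd nat \<bar>k\<bar>})"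
      using card_factor_pairs_le(2)[OF k(1)] by linarith
    also have "\<dots> \<le> 2 * (C * real (nat \<bar>k\<bar>) powr (\<epsilon> / 2))"
      using k(1) by (intro mult_left_mono C(2)) auto
    also have "real (nat \<bar>k\<bar>) powr (\<epsilon> / 2) \<le> (2 * X\<^sup>2) powr (\<epsilon> / 2)"
      using k(2) assms by (intro powr_mono2) auto
    also have "(2 * X\<^sup>2) powr (\<epsilon> / 2) = 2 powr (\<epsilon> / 2) * X powr \<epsilon>"
      using X powr_powr[of X 2 "\<epsilon> / 2"] by (simp add: powr_mult)
    finally show "finite {(u, v). u * v = k} \<and>
        real (card {(u, v). u * v = k}) \<le> 2 * C * 2 powr (\<epsilon> / 2) * X powr \<epsilon>"
      using C(1) card_factor_pairs_le(1)[OF k(1)] by (simp add: mult.assoc)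
  qed (use C(1) in auto)
qed

lemma card_zero_factor_pairs:
  assumes "X \<ge> 1"
  defines "Z \<equiv> {(u::int, v::int). u * v = 0 \<and> \<bar>real_of_int u\<bar> \<le> X \<and> \<bar>real_of_int v\<bar> \<le> X}"
  shows "finite Z" "real (card Z) \<le> 6 * X"
proof -
  let ?I = "{u::int. \<bar>real_of_int u\<bar> \<le> X}"
  have Z: "Z \<subseteq> Pair 0 ` ?I \<union> (\<lambda>u. (u, 0)) ` ?I" by (auto simp: Z_def)
  then show "finite Z" using card_int_le(1)[OF assms(1)] finite_subset by blast
  have "card Z \<le> card (Pair (0::int) ` ?I) + card ((\<lambda>u. (u, 0::int)) ` ?I)"
    using card_mono[OF _ Z] card_int_le(1)[OF assms(1)] card_Un_le by (meson finite_Un finite_imageI order.trans)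
  also have "\<dots> \<le> card ?I + card ?I"
    using card_int_le(1)[OF assms(1)] by (intro add_mono card_image_le)
  finally show "real (card Z) \<le> 6 * X" using card_int_le(2)[OF assms(1)] by linarith
qed

lemma powr_ge_1: "X \<ge> 1 \<Longrightarrow> \<epsilon> > 0 \<Longrightarrow> X powr \<epsilon> \<ge> (1::real)"
  by (simp add: ge_one_powr_ge_zero)

text \<open>The upper left entry and the trace, with at most \<open>3 * X\<close> and
  \<open>5\<close> values, fix the diagonal and thereby the product of the off-diagonal entries. If
  that product is \<open>0\<close>, the diagonal is \<open>1, 1\<close> or \<open>-1, -1\<close>,
  which leaves at most \<open>12 * X\<close> matrices.\<close>

lemma card_small_trace:
  fixes \<epsilon> :: real
  assumes "\<epsilon> > 0"
  obtains C where "C > 0"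
    "\<And>X. X \<ge> 1 \<Longrightarrow> finite (small_trace X) \<and> real (card (small_trace X)) \<le> C * X powr (1 + \<epsilon>)"
proof -
  obtain C where C: "C > 0" "\<And>X k. X \<ge> 1 \<Longrightarrow> k \<noteq> 0 \<Longrightarrow> \<bar>real_of_int k\<bar> \<le> 2 * X\<^sup>2 \<Longrightarrow>
      finite {(u, v). u * v = k} \<and> real (card {(u, v). u * v = k}) \<le> C * X powr \<epsilon>"
    using card_bounded_factor_pairs[OF assms] by metis
  show ?thesis
  proof (rule that[of "12 + 15 * C"])
    fix X :: real assume X: "X \<ge> 1"
    let ?I = "{u::int. \<bar>real_of_int u\<bar> \<le> X}"
    let ?f = "\<lambda>A :: int^2^2. (A$1$1, A$1$1 + A$2$2)"
    let ?g = "\<lambda>A :: int^2^2. (A$1$2, A$2$1)"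
    let ?S0 = "{A \<in> small_trace X. A$1$2 * A$2$1 = 0}"
    let ?S1 = "{A \<in> small_trace X. A$1$2 * A$2$1 \<noteq> 0}"
    have det: "A$1$2 * A$2$1 = A$1$1 * A$2$2 - 1" if "A \<in> small_trace X" for A
      using that by (simp add: small_trace_def SL2Z_upto_def det_2)
    have bd: "\<bar>real_of_int (A$i$j)\<bar> \<le> X" if "A \<in> small_trace X" for A i j
      using that by (simp add: small_trace_def SL2Z_upto_def)
    have fI: "finite ?I" "real (card ?I) \<le> 3 * X" using card_int_le[OF X] by auto
    let ?Z = "{(u, v). u * v = 0 \<and> \<bar>real_of_int u\<bar> \<le> X \<and> \<bar>real_of_int v\<bar> \<le> X}"
    let ?h = "\<lambda>(e, b, c). vector [vector [e, b], vector [c, e]] :: int^2^2"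
    have sub0: "?S0 \<subseteq> ?h ` ({1, -1} \<times> ?Z)"
    proof
      fix A assume A: "A \<in> ?S0"
      then have "A$1$2 * A$2$1 = 0" "A \<in> small_trace X" by blast+
      then have "A$1$1 * A$2$2 = 1" using det[of A] by linarith
      then have "A$1$1 = A$2$2 \<and> A$1$1 \<in> {1, -1}" using zmult_eq_1_iff by fastforce
      then show "A \<in> ?h ` ({1, -1} \<times> ?Z)"
        using A bd[of A] by (intro image_eqI[of _ _ "(A$1$1, A$1$2, A$2$1)"]) (auto simp: vec_eq_iff forall_2)
    qed
    note Z = card_zero_factor_pairs[OF X]
    have f0: "finite ?S0" using finite_subset[OF sub0] Z(1) by simp
    have "card ?S0 \<le> card ({1, -1 :: int} \<times> ?Z)"
      using sub0 Z(1) by (intro surj_card_le) auto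
    then have S0: "real (card ?S0) \<le> 12 * X"
      using Z(2) by (simp add: card_cartesian_product)
    have im: "?f ` ?S1 \<subseteq> ?I \<times> {-2..2}"
      using bd by (auto simp: small_trace_def abs_le_iff)
    have fib: "finite {A \<in> ?S1. ?f A = y} \<and> real (card {A \<in> ?S1. ?f A = y}) \<le> C * X powr \<epsilon>"
      if "y \<in> ?I \<times> {-2..2}" for y
    proof (cases "{A \<in> ?S1. ?f A = y} = {}")
      case True
      show ?thesis unfolding True using C(1) by simp
    next
      case False
      then obtain A0 where A0: "A0 \<in> ?S1" "?f A0 = y" by blast
      define k where "k = A0$1$1 * A0$2$2 - 1"
      let ?P = "{(u, v). u * v = k}"
      have "\<bar>real_of_int (A0$1$1) * real_of_int (A0$2$2)\<bar> \<le> X * X"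
        unfolding abs_mult using bd[of A0] A0(1) X by (intro mult_mono) auto
      moreover have "1 \<le> X * X" using X by (metis mult_mono mult_1 order.trans zero_le_one)
      ultimately have "\<bar>real_of_int k\<bar> \<le> 2 * X\<^sup>2"
        by (simp add: k_def power2_eq_square)
      moreover have "k \<noteq> 0" using A0 det[of A0] by (auto simp: k_def)
      ultimately have P: "finite ?P" "real (card ?P) \<le> C * X powr \<epsilon>" using C(2) X by blast+
      have inj: "inj_on ?g {A \<in> ?S1. ?f A = y}"
        by (rule inj_onI) (auto simp: vec_eq_iff forall_2)
      have img: "?g ` {A \<in> ?S1. ?f A = y} \<subseteq> ?P"
        using A0 det by (auto simp: k_def)
      have "card {A \<in> ?S1. ?f A = y} \<le> card ?P"
        by (rule card_inj_on_le[OF inj img P(1)])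
      then show ?thesis using P inj_on_finite[OF inj img P(1)] by auto
    qed
    have fin: "finite (?I \<times> {-2..2::int})" using fI by simp
    have f1: "finite ?S1" by (rule card_le_card_times_fibres(1)[OF fin im fib])
    have "real (card ?S1) \<le> real (card (?I \<times> {-2..2::int})) * (C * X powr \<epsilon>)"
      by (rule card_le_card_times_fibres(2)[OF fin im fib])
    also have "\<dots> \<le> (15 * X) * (C * X powr \<epsilon>)"
      using fI C(1) by (intro mult_right_mono) (auto simp: card_cartesian_product)
    finally have S1: "real (card ?S1) \<le> 15 * C * (X * X powr \<epsilon>)" by (simp add: mult_ac)
    have un: "small_trace X = ?S0 \<union> ?S1" by auto
    have "card (small_trace X) \<le> card ?S0 + card ?S1" by (subst un) (rule card_Un_le)
    then have "real (card (small_trace X)) \<le> 12 * X + 15 * C * (X * X powr \<epsilon>)"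
      using S0 S1 by linarith
    also have "12 * X \<le> 12 * (X * X powr \<epsilon>)" using powr_ge_1[OF X assms] X by simp
    finally have "real (card (small_trace X)) \<le> (12 + 15 * C) * (X * X powr \<epsilon>)"
      by (simp add: distrib_right)
    moreover have "X * X powr \<epsilon> = X powr (1 + \<epsilon>)" using X by (simp add: powr_add)
    moreover have "finite (small_trace X)" by (subst un) (use f0 f1 in simp)
    ultimately show "finite (small_trace X) \<and> real (card (small_trace X)) \<le> (12 + 15 * C) * X powr (1 + \<epsilon>)"
      by simp
  qed (use C(1) in simp)
qed

text \<open>The quotients by \<open>Q\<close> are integers of size at most
  \<open>X / real Q\<close>. As \<open>real Q \<le> X\<close>, this bound is at least
  \<open>1\<close>, so the multiple \<open>0\<close> is absorbed into the constant
  \<open>3\<close>.\<close>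

lemma card_multiples_le:
  assumes "1 \<le> Q" "real Q \<le> X"
  shows "finite {c::int. \<bar>real_of_int c\<bar> \<le> X \<and> int Q dvd c}"
    "real (card {c::int. \<bar>real_of_int c\<bar> \<le> X \<and> int Q dvd c}) \<le> 3 * X / real Q"
proof -
  have r: "1 \<le> X / real Q" using assms by (simp add: le_divide_eq)
  let ?I = "{t::int. \<bar>real_of_int t\<bar> \<le> X / real Q}"
  have sub: "{c::int. \<bar>real_of_int c\<bar> \<le> X \<and> int Q dvd c} \<subseteq> (\<lambda>t. int Q * t) ` ?I"
  proof
    fix c assume "c \<in> {c::int. \<bar>real_of_int c\<bar> \<le> X \<and> int Q dvd c}"
    then obtain t where t: "c = int Q * t" "\<bar>real_of_int c\<bar> \<le> X" by blast
    then have "\<bar>real_of_int t\<bar> * real Q \<le> X" by (simp add: abs_mult mult.commute[of "real Q"])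
    then have "\<bar>real_of_int t\<bar> \<le> X / real Q" using assms by (simp add: le_divide_eq)
    then show "c \<in> (\<lambda>t. int Q * t) ` ?I" using t(1) by blast
  qed
  show "finite {c::int. \<bar>real_of_int c\<bar> \<le> X \<and> int Q dvd c}"
    using finite_subset[OF sub] card_int_le(1)[OF r] by blast
  have "card {c::int. \<bar>real_of_int c\<bar> \<le> X \<and> int Q dvd c} \<le> card ?I"
    using sub card_int_le(1)[OF r] by (rule surj_card_le[rotated])
  then show "real (card {c::int. \<bar>real_of_int c\<bar> \<le> X \<and> int Q dvd c}) \<le> 3 * X / real Q"
    using card_int_le(2)[OF r] by simp
qed

text \<open>The off-diagonal entries, the lower one a multiple of \<open>Q\<close>, fix the product
  of the diagonal ones. If that product is \<open>0\<close>, the off-diagonal entries are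
  \<open>1, -1\<close> or \<open>-1, 1\<close>.\<close>

lemma card_Gamma0_upto_le:
  fixes \<epsilon> :: real
  assumes "\<epsilon> > 0"
  obtains C where "C > 0"
    "\<And>X Q. 1 \<le> Q \<Longrightarrow> real Q \<le> X \<Longrightarrow> real (card (Gamma0_upto Q X)) \<le> C * X powr (2 + \<epsilon>) / real Q"
proof -
  obtain C where C: "C > 0" "\<And>X k. X \<ge> 1 \<Longrightarrow> k \<noteq> 0 \<Longrightarrow> \<bar>real_of_int k\<bar> \<le> 2 * X\<^sup>2 \<Longrightarrow>
      finite {(u, v). u * v = k} \<and> real (card {(u, v). u * v = k}) \<le> C * X powr \<epsilon>"
    using card_bounded_factor_pairs[OF assms] by metis
  show ?thesis
  proof (rule that[of "12 + 9 * C"])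
    fix X :: real and Q :: nat assume Q: "1 \<le> Q" "real Q \<le> X"
    have X: "X \<ge> 1" using Q by linarith
    let ?G = "Gamma0_upto Q X"
    let ?I = "{u::int. \<bar>real_of_int u\<bar> \<le> X}"
    let ?J = "{c::int. \<bar>real_of_int c\<bar> \<le> X \<and> int Q dvd c}"
    let ?f = "\<lambda>A :: int^2^2. (A$1$2, A$2$1)"
    let ?g = "\<lambda>A :: int^2^2. (A$1$1, A$2$2)"
    let ?S0 = "{A \<in> ?G. A$1$1 * A$2$2 = 0}"
    let ?S1 = "{A \<in> ?G. A$1$1 * A$2$2 \<noteq> 0}"
    have det: "A$1$1 * A$2$2 = A$1$2 * A$2$1 + 1" if "A \<in> ?G" for A
      using that by (simp add: Gamma0_upto_eq SL2Z_upto_def det_2)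
    have bd: "\<bar>real_of_int (A$i$j)\<bar> \<le> X" if "A \<in> ?G" for A i j
      using that by (simp add: Gamma0_upto_eq SL2Z_upto_def)
    have fI: "finite ?I" "real (card ?I) \<le> 3 * X" using card_int_le[OF X] by auto
    have fJ: "finite ?J" "real (card ?J) \<le> 3 * X / real Q" using card_multiples_le[OF Q] by auto
    let ?Z = "{(u, v). u * v = 0 \<and> \<bar>real_of_int u\<bar> \<le> X \<and> \<bar>real_of_int v\<bar> \<le> X}"
    let ?h = "\<lambda>(e, a, d). vector [vector [a, e], vector [- e, d]] :: int^2^2"
    have sub0: "?S0 \<subseteq> ?h ` ({1, -1} \<times> ?Z)"
    proof
      fix A assume A: "A \<in> ?S0"
      then have "A$1$1 * A$2$2 = 0" "A \<in> ?G" by blast+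
      then have "A$1$2 * (- A$2$1) = 1" unfolding mult_minus_right using det[of A] by linarith
      then have "A$1$2 \<in> {1, -1}" "A$2$1 = - A$1$2" unfolding zmult_eq_1_iff by auto
      then show "A \<in> ?h ` ({1, -1} \<times> ?Z)"
        using A bd[of A] by (intro image_eqI[of _ _ "(A$1$2, A$1$1, A$2$2)"]) (auto simp: vec_eq_iff forall_2)
    qed
    note Z = card_zero_factor_pairs[OF X]
    have "card ?S0 \<le> card ({1, -1 :: int} \<times> ?Z)"
      using sub0 Z(1) by (intro surj_card_le) auto
    then have "real (card ?S0) \<le> 12 * X"
      using Z(2) by (simp add: card_cartesian_product)
    then have "real (card ?S0) \<le> 12 * X * 1" by simp
    \<comment> \<open>Both \<open>X / real Q\<close> and \<open>X powr \<epsilon>\<close> are at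
      least \<open>1\<close>, so the matrices with zero diagonal product fit under the main
      term.\<close>
    also have "12 * X * 1 \<le> 12 * X * (X / real Q * X powr \<epsilon>)"
      using powr_ge_1[OF X assms] X Q mult_mono[of 1 "X / real Q" 1 "X powr \<epsilon>"]
      by (intro mult_left_mono) (simp_all add: le_divide_eq)
    finally have S0: "real (card ?S0) \<le> 12 * (X * X / real Q * X powr \<epsilon>)" by simp
    have im: "?f ` ?S1 \<subseteq> ?I \<times> ?J"
      using bd by (auto simp: Gamma0_upto_eq)
    have fib: "finite {A \<in> ?S1. ?f A = y} \<and> real (card {A \<in> ?S1. ?f A = y}) \<le> C * X powr \<epsilon>"
      if "y \<in> ?I \<times> ?J" for y
    proof (cases "{A \<in> ?S1. ?f A = y} = {}")
      case True
      show ?thesis unfolding True using C(1) by simp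
    next
      case False
      then obtain A0 where A0: "A0 \<in> ?S1" "?f A0 = y" by blast
      define k where "k = A0$1$2 * A0$2$1 + 1"
      let ?P = "{(u, v). u * v = k}"
      have "\<bar>real_of_int (A0$1$2) * real_of_int (A0$2$1)\<bar> \<le> X * X"
        unfolding abs_mult using bd[of A0] A0(1) X by (intro mult_mono) auto
      moreover have "1 \<le> X * X" using X by (metis mult_mono mult_1 order.trans zero_le_one)
      ultimately have "\<bar>real_of_int k\<bar> \<le> 2 * X\<^sup>2"
        by (simp add: k_def power2_eq_square)
      moreover have "k \<noteq> 0" using A0 det[of A0] by (auto simp: k_def)
      ultimately have P: "finite ?P" "real (card ?P) \<le> C * X powr \<epsilon>" using C(2) X by blast+
      have inj: "inj_on ?g {A \<in> ?S1. ?f A = y}"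
        by (rule inj_onI) (auto simp: vec_eq_iff forall_2)
      have img: "?g ` {A \<in> ?S1. ?f A = y} \<subseteq> ?P"
        using A0 det by (auto simp: k_def)
      have "card {A \<in> ?S1. ?f A = y} \<le> card ?P"
        by (rule card_inj_on_le[OF inj img P(1)])
      then show ?thesis using P inj_on_finite[OF inj img P(1)] by auto
    qed
    have fin: "finite (?I \<times> ?J)" using fI(1) fJ(1) by (rule finite_cartesian_product)
    have IJ: "real (card (?I \<times> ?J)) \<le> (3 * X) * (3 * X / real Q)"
      unfolding card_cartesian_product of_nat_mult using fI fJ X by (intro mult_mono) auto
    have "real (card ?S1) \<le> real (card (?I \<times> ?J)) * (C * X powr \<epsilon>)"
      by (rule card_le_card_times_fibres(2)[OF fin im fib])
    also have "\<dots> \<le> (3 * X) * (3 * X / real Q) * (C * X powr \<epsilon>)"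
      using IJ C(1) by (intro mult_right_mono) auto
    finally have S1: "real (card ?S1) \<le> 9 * C * (X * X / real Q * X powr \<epsilon>)"
      by (simp add: mult_ac)
    have un: "?G = ?S0 \<union> ?S1" by auto
    have "card ?G \<le> card ?S0 + card ?S1" by (subst un) (rule card_Un_le)
    then have le: "real (card ?G) \<le> (12 + 9 * C) * (X * X / real Q * X powr \<epsilon>)"
      using S0 S1 unfolding distrib_right by linarith
    have eq: "X * X / real Q * X powr \<epsilon> = X powr (2 + \<epsilon>) / real Q"
      using X by (simp add: powr_add power2_eq_square)
    show "real (card ?G) \<le> (12 + 9 * C) * X powr (2 + \<epsilon>) / real Q"
      using le unfolding eq by simp
  qed (use C(1) in simp)
qed

section \<open>From matrices to tuples\<close>

lemma nonfree_count_le: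
  assumes "X \<ge> 1" "finite (small_trace X)" "real (card (small_trace X)) \<le> T" "T \<ge> 1200 * X"
  shows "real (nonfree_count s Q X) \<le> real (s + s * s) * (real (card (Gamma0_upto Q X)) ^ (s - 1) * T)"
proof -
  let ?G = "Gamma0_upto Q X"
  let ?rest = "\<lambda>i As. take i As @ drop (Suc i) (As :: (int^2^2) list)"
  let ?P = "\<lambda>i F. {As. length As = s \<and> set As \<subseteq> ?G \<and> As ! i \<in> F (?rest i As)}"
  \<comment> \<open>The list \<open>R\<close> lacks entry \<open>i\<close>, so later entries have
    moved down by one. The pairs \<open>j = i\<close> are counted along, harmlessly, since the bound
    on \<open>linked X B\<close> holds for every \<open>B\<close>.\<close>
  let ?L = "\<lambda>i j R. linked X (R ! (if j < i then j else j - 1))"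
  have P: "real (card (?P i F)) \<le> real (card ?G) ^ (s - 1) * T"
    if "i < s" "\<And>R. finite (F R) \<and> real (card (F R)) \<le> T" for i F
    by (rule card_lists_constrained_entry_le[OF finite_Gamma0_upto that])
  have rest: "?rest i As ! (if j < i then j else j - 1) = As ! j"
    if "i < length As" "j < length As" "i \<noteq> j" for i j As
    using that by (auto simp: nth_append)
  \<comment> \<open>There are \<open>s\<close> positions for an entry of small trace and
    \<open>s * s\<close> pairs for a linked one.\<close>
  let ?U = "(\<Union>i<s. ?P i (\<lambda>_. small_trace X)) \<union> (\<Union>i<s. \<Union>j<s. ?P i (?L i j))"
  have finP: "finite (?P i F)" for i F
    by (rule finite_subset[OF _ finite_lists_length_eq[OF finite_Gamma0_upto, of Q X s]]) auto
  have "nonfree_tuples s Q X \<subseteq> ?U"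
  proof
    fix As assume "As \<in> nonfree_tuples s Q X"
    then have As: "length As = s" "set As \<subseteq> ?G" "\<not> free_generators SL2Z As"
      by (auto simp: nonfree_tuples_def)
    then have "set As \<subseteq> SL2Z_upto X" by (auto simp: Gamma0_upto_eq)
    from nonfree_cases[OF this As(3)] show "As \<in> ?U"
    proof
      assume "\<exists>i<length As. As ! i \<in> small_trace X"
      then show ?thesis using As by auto
    next
      assume "\<exists>i<length As. \<exists>j<length As. i \<noteq> j \<and> As ! i \<in> linked X (As ! j)"
      then obtain i j where ij: "i < length As" "j < length As" "i \<noteq> j" "As ! i \<in> linked X (As ! j)"
        by blast
      then have "As \<in> ?P i (?L i j)" using rest[OF ij(1-3)] As by simp
      then show ?thesis using ij As(1) by blast
    qed
  qed
  moreover have "finite ?U" by (intro finite_UnI finite_UN_I finite_lessThan finP)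
  ultimately have "nonfree_count s Q X \<le> card ?U"
    unfolding nonfree_count_def by (intro card_mono)
  also have "\<dots> \<le> (\<Sum>i<s. card (?P i (\<lambda>_. small_trace X))) + (\<Sum>i<s. \<Sum>j<s. card (?P i (?L i j)))"
    by (intro order.trans[OF card_Un_le] add_mono order.trans[OF card_UN_le] sum_mono finite_lessThan order.refl)
  finally have "real (nonfree_count s Q X) \<le> (\<Sum>i<s. real (card (?P i (\<lambda>_. small_trace X)))) +
      (\<Sum>i<s. \<Sum>j<s. real (card (?P i (?L i j))))"
    unfolding of_nat_sum[symmetric] of_nat_add[symmetric] of_nat_le_iff .
  also have "\<dots> \<le> (\<Sum>i<s. real (card ?G) ^ (s - 1) * T) + (\<Sum>i<s. \<Sum>j<s. real (card ?G) ^ (s - 1) * T)"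
  proof (intro add_mono sum_mono P)
    show "finite (linked X B) \<and> real (card (linked X B)) \<le> T" for B
      using card_linked[OF assms(1), of B] assms(4) by simp
  qed (use assms in auto)
  also have "\<dots> = real (s + s * s) * (real (card ?G) ^ (s - 1) * T)"
    by (simp add: distrib_right)
  finally show ?thesis .
qed

theorem theorem1p1:
  fixes s :: nat
  assumes "s \<ge> 1"
  shows "\<forall>\<epsilon>::real. \<epsilon> > 0 \<longrightarrow>
    (\<exists>X\<^sub>0::real. \<forall>X::real. X \<ge> X\<^sub>0 \<longrightarrow>
      (\<forall>Q::nat. 1 \<le> Q \<and> real Q \<le> X \<longrightarrow>
        real (nonfree_count s Q X) \<le>
          X powr (2 * real s - 1 + \<epsilon>) * real Q powr (- real s + 1)))"
proof (intro allI impI)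
  fix \<epsilon> :: real assume "\<epsilon> > 0"
  \<comment> \<open>The exponents of \<open>X\<close> add up to \<open>(s - 1) * (2 + \<eta>) + (1 +
    \<eta>) = 2 * s - 1 + s * \<eta>\<close>. This choice makes \<open>s * \<eta>\<close> half of
    \<epsilon> and leaves the other half for the constant \<open>K\<close>.\<close>
  define \<eta> where "\<eta> = \<epsilon> / (2 * real s)"
  have \<eta>: "\<eta> > 0" using \<open>\<epsilon> > 0\<close> assms by (simp add: \<eta>_def)
  obtain C where C: "C > 0"
    "\<And>X. X \<ge> 1 \<Longrightarrow> finite (small_trace X) \<and> real (card (small_trace X)) \<le> C * X powr (1 + \<eta>)"
    using card_small_trace[OF \<eta>] by metis
  obtain D where D: "D > 0" "\<And>X Q. 1 \<le> Q \<Longrightarrow> real Q \<le> X \<Longrightarrow>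
      real (card (Gamma0_upto Q X)) \<le> D * X powr (2 + \<eta>) / real Q"
    using card_Gamma0_upto_le[OF \<eta>] by metis
  define K where "K = real (s + s * s) * (D ^ (s - 1) * (C + 1200))"
  have "s + s * s > 0" using assms by simp
  then have "real (s + s * s) > 0" by (simp only: of_nat_0_less_iff)
  then have K: "K > 0" unfolding K_def using C(1) D(1) by (intro mult_pos_pos zero_less_power) auto
  show "\<exists>X\<^sub>0::real. \<forall>X\<ge>X\<^sub>0. \<forall>Q::nat. 1 \<le> Q \<and> real Q \<le> X \<longrightarrow>
      real (nonfree_count s Q X) \<le> X powr (2 * real s - 1 + \<epsilon>) * real Q powr (- real s + 1)"
  proof (intro exI[of _ "K powr (2 / \<epsilon>)"] allI impI, elim conjE)
    fix X :: real and Q :: nat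
    assume XK: "X \<ge> K powr (2 / \<epsilon>)" and Q: "1 \<le> Q" "real Q \<le> X"
    have X: "X \<ge> 1" using Q by linarith
    \<comment> \<open>One bound for both kinds of constrained entry: \<open>C\<close> serves small
      trace, \<open>1200\<close> serves linked matrices.\<close>
    define T where "T = (C + 1200) * X powr (1 + \<eta>)"
    have "X \<le> X powr (1 + \<eta>)" using X \<eta> powr_mono[of 1 "1 + \<eta>" X] by simp
    moreover have "0 \<le> C * X powr (1 + \<eta>)" "0 \<le> X powr (1 + \<eta>)" using C(1) by simp_all
    moreover have "real (card (small_trace X)) \<le> C * X powr (1 + \<eta>)" using C(2)[OF X] by blast
    ultimately have T: "real (card (small_trace X)) \<le> T" "1200 * X \<le> T" "T \<ge> 0"
      unfolding T_def distrib_right by linarith+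
    have exps: "real (s - 1) = real s - 1" using assms by (simp add: of_nat_diff)
    have "real (nonfree_count s Q X) \<le>
        real (s + s * s) * (real (card (Gamma0_upto Q X)) ^ (s - 1) * T)"
      using nonfree_count_le[OF X _ T(1,2)] C(2)[OF X] by blast
    also have "\<dots> \<le> real (s + s * s) * ((D * X powr (2 + \<eta>) / real Q) ^ (s - 1) * T)"
      using D(2)[OF Q] T(3) by (intro mult_left_mono mult_right_mono power_mono) auto
    also have "\<dots> = K * ((X powr (2 + \<eta>)) ^ (s - 1) * X powr (1 + \<eta>) * (1 / real Q ^ (s - 1)))"
      unfolding K_def T_def power_mult_distrib power_divide by simp
    also have "(X powr (2 + \<eta>)) ^ (s - 1) = X powr ((real s - 1) * (2 + \<eta>))"
      using X powr_power[of X "2 + \<eta>" "s - 1"] unfolding exps by simp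
    also have "X powr ((real s - 1) * (2 + \<eta>)) * X powr (1 + \<eta>) = X powr (2 * real s - 1 + real s * \<eta>)"
      unfolding powr_add[symmetric] by (simp add: algebra_simps)
    also have "real s * \<eta> = \<epsilon> / 2" using assms by (simp add: \<eta>_def)
    also have "1 / real Q ^ (s - 1) = 1 / real Q powr real (s - 1)"
      using Q(1) by (simp add: powr_realpow)
    also have "\<dots> = real Q powr (- real s + 1)"
      unfolding powr_minus_divide[symmetric] exps by simp
    also have "K * (X powr (2 * real s - 1 + \<epsilon> / 2) * real Q powr (- real s + 1)) \<le>
        X powr (\<epsilon> / 2) * (X powr (2 * real s - 1 + \<epsilon> / 2) * real Q powr (- real s + 1))"
    proof (intro mult_right_mono)
      \<comment> \<open>The threshold \<open>K powr (2 / \<epsilon>)\<close> is the point where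
        \<open>X powr (\<epsilon> / 2)\<close> reaches \<open>K\<close>.\<close>
      have "K = (K powr (2 / \<epsilon>)) powr (\<epsilon> / 2)" using K \<open>\<epsilon> > 0\<close> by (simp add: powr_powr)
      also have "\<dots> \<le> X powr (\<epsilon> / 2)" using XK \<open>\<epsilon> > 0\<close> by (intro powr_mono2) auto
      finally show "K \<le> X powr (\<epsilon> / 2)" .
    qed simp
    also have "\<dots> = X powr (2 * real s - 1 + \<epsilon>) * real Q powr (- real s + 1)"
      unfolding mult.assoc[symmetric] powr_add[symmetric] by (simp add: add.commute)
    finally show "real (nonfree_count s Q X) \<le>
      X powr (2 * real s - 1 + \<epsilon>) * real Q powr (- real s + 1)" .
  qed
qed

end
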